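(* Let $\xi\in\mathbb{R}$. For $q\geqslant 0$ let \[ \mathcal{C}_{\xi}(e^{q})=\{(x,y)\in\mathbb{R}^2:\ |x|\leqslant e^{q},\ |x\xi-y|\leqslant e^{-q}\}, \] and for $j=1,2$ let $L_{\xi,j}(q)=\log\lambda_j(\mathcal{C}_{\xi}(e^{q}))$, where $\lambda_j(\mathcal{C})$ is the smallest $\lambda\geqslant 0$ such that $\lambda\mathcal{C}$ contains at least $j$ linearly independent points of $\mathbb{Z}^2$. Let $\mathbf{\Gamma}_{\xi}\subset[0,\infty)\times\mathbb{R}$ be the union of the graphs of $L_{\xi,1}$ and $L_{\xi,2}$ on $[0,\infty)$. Let $\Vert\xi\Vert$ denote the distance from $\xi$ to the nearest integer. Then $\mathbf{\Gamma}_{\xi}=\mathbf{\Gamma}_{\Vert\xi\Vert}$, i.e. this graph depends only on $\Vert\xi\Vert$. Moreover, let $(q_n)_{0\leqslant n<s}$, with $s\in\{1,2,3,\dots\}\cup\{\infty\}$, be the increasing sequence of all points of $[0,\infty)$ at which the function $L_{\xi,1}:[0,\infty)\to\mathbb{R}$ admits a local maximum, and for each integer $n$ with $1\leqslant n<s$ let $a_n$ be the number of local maxima of $L_{\xi,2}$ restricted to the interval $[q_{n-1},q_n]$. Then $q_0=0$, and the simple continued fraction expansion of $\Vert\xi\Vert$ is \[ \Vert\xi\Vert=\begin{cases}[0] & \text{if } s=1,\\ [0,a_1,a_2,\dots,a_{s-1}] & \text{if } 2\leqslant s<\infty,\\ [0,a_1,a_2,\dots] & \text{if } s=\infty,\end{cases}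 \] with $a_{s-1}\geqslant 2$ if $2\leqslant s<\infty$.
   Context: The functions $L_{\xi,1},L_{\xi,2}$ are continuous and piecewise linear on $[0,\infty)$; "local maximum" of a function on $[0,\infty)$ includes a possible local maximum at the endpoint $0$. $[0,a_1,a_2,\dots]$ denotes the simple continued fraction $0+\cfrac{1}{a_1+\cfrac{1}{a_2+\cdots}}$. *)

theory Defs
  imports "HOL-Analysis.Analysis" "HOL-Library.Extended_Nat"
begin

definition int_lattice :: "(real \<times> real) set" where
  "int_lattice = \<int> \<times> \<int>"

definition succ_min :: "nat \<Rightarrow> (real \<times> real) set \<Rightarrow> real" where
  "succ_min j C = (LEAST l. 0 \<le> l \<and>
     (\<exists>S. S \<subseteq> (\<lambda>p. l *\<^sub>R p) ` C \<inter> int_lattice \<and> independent S \<and> card S = j))"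

definition convex_body :: "real \<Rightarrow> real \<Rightarrow> (real \<times> real) set" where
  "convex_body \<xi> Q = {(x, y). \<bar>x\<bar> \<le> Q \<and> \<bar>x * \<xi> - y\<bar> \<le> 1 / Q}"

definition L :: "real \<Rightarrow> nat \<Rightarrow> real \<Rightarrow> real" where
  "L \<xi> j q = ln (succ_min j (convex_body \<xi> (exp q)))"

definition combined_graph :: "real \<Rightarrow> (real \<times> real) set" where
  "combined_graph \<xi> = {(q, L \<xi> j q) | q j. 0 \<le> q \<and> j \<in> {1, 2}}"

definition dist_int :: "real \<Rightarrow> real" where
  "dist_int \<xi> = \<bar>\<xi> - of_int (round \<xi>)\<bar>"

text \<open>The points at which the restriction of \<open>f\<close> to \<open>S\<close> has a local maximum; end points of
  \<open>S\<close> are compared only with neighbours inside \<open>S\<close>.\<close>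

definition local_maxima_on :: "real set \<Rightarrow> (real \<Rightarrow> real) \<Rightarrow> real set" where
  "local_maxima_on S f = {x \<in> S. \<forall>\<^sub>F y in at x within S. f y \<le> f x}"

definition increasing_enumeration :: "real set \<Rightarrow> enat \<Rightarrow> (nat \<Rightarrow> real) \<Rightarrow> bool" where
  "increasing_enumeration A s q \<longleftrightarrow>
     strict_mono_on {n. enat n < s} q \<and> q ` {n. enat n < s} = A"

fun cfrac :: "int \<Rightarrow> nat list \<Rightarrow> real" where
  "cfrac a0 [] = of_int a0"
| "cfrac a0 (a # as) = of_int a0 + 1 / cfrac (int a) as"

definition has_finite_cfrac :: "real \<Rightarrow> int \<Rightarrow> nat list \<Rightarrow> bool" where
  "has_finite_cfrac x a0 as \<longleftrightarrow> (\<forall>a \<in> set as. 1 \<le> a) \<and> x = cfrac a0 as"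

text \<open>The partial quotients after \<open>a0\<close> are \<open>a 1, a 2, \<dots>\<close>; the value \<open>a 0\<close> is irrelevant.\<close>

definition has_infinite_cfrac :: "real \<Rightarrow> int \<Rightarrow> (nat \<Rightarrow> nat) \<Rightarrow> bool" where
  "has_infinite_cfrac x a0 a \<longleftrightarrow>
     (\<forall>n \<ge> 1. 1 \<le> a n) \<and> (\<lambda>m. cfrac a0 (map a [1..<Suc m])) \<longlonglongrightarrow> x"

end

theory Submission imports Defs begin

text \<open>
  After the reduction to \<open>\<theta> = \<parallel>\<xi>\<parallel> \<in> [0, 1/2]\<close> write \<open>X\<close> for the first coordinate of an integer point and
  \<open>D\<close> for the absolute value of \<open>x \<theta> - y\<close> there; the point has gauge \<open>max (X e\<^sup>-\<^sup>q) (D e\<^sup>q)\<close>. For a unimodular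
  basis \<open>u, w\<close> with \<open>X \<ge> 0\<close> and linear forms of opposite signs, an integer combination \<open>a u + b w\<close>
  adds up the \<open>X\<close> if \<open>a b \<ge> 0\<close> and the \<open>D\<close> if \<open>a b \<le> 0\<close>. Hence the first minimum is at least
  \<open>min (X\<^sub>w e\<^sup>-\<^sup>q) (D\<^sub>u e\<^sup>q)\<close>, and every point outside the line of \<open>u\<close> has gauge at least
  \<open>min ((X\<^sub>u + X\<^sub>w) e\<^sup>-\<^sup>q) (D\<^sub>w e\<^sup>q)\<close>. With the convergents these bounds make the first minimum a lower
  envelope of gauges, whose local maxima are the crossings of the rising branch of one convergent
  with the falling branch of the next. Between two such crossings the second minimum is in the same
  way the lower envelope of the gauges of the intermediate convergents, and the partial quotient
  counts their crossings.
\<close>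

subsection \<open>Local maxima of lower envelopes\<close>

lemma not_local_max_left:
  assumes "c < q" "{c..q} \<subseteq> S" "\<And>y. c \<le> y \<Longrightarrow> y < q \<Longrightarrow> f q < f y"
  shows "q \<notin> local_maxima_on S f"
proof
  assume "q \<in> local_maxima_on S f"
  then have "\<forall>\<^sub>F y in at q within S. f y \<le> f q" by (simp add: local_maxima_on_def)
  then obtain d where d: "d > 0" "\<And>y. y \<in> S \<Longrightarrow> y \<noteq> q \<Longrightarrow> dist y q < d \<Longrightarrow> f y \<le> f q"
    by (auto simp: eventually_at)
  define y where "y = max c (q - d/2)"
  have "c \<le> y" "y < q" "dist y q < d" using d(1) assms(1) by (auto simp: y_def dist_real_def max_def)
  moreover from this have "y \<in> S" using assms(2) by auto
  ultimately show False using d(2)[of y] assms(3)[of y] by auto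
qed

lemma not_local_max_right:
  assumes "q < c" "{q..c} \<subseteq> S" "\<And>y. q < y \<Longrightarrow> y \<le> c \<Longrightarrow> f q < f y"
  shows "q \<notin> local_maxima_on S f"
proof
  assume "q \<in> local_maxima_on S f"
  then have "\<forall>\<^sub>F y in at q within S. f y \<le> f q" by (simp add: local_maxima_on_def)
  then obtain d where d: "d > 0" "\<And>y. y \<in> S \<Longrightarrow> y \<noteq> q \<Longrightarrow> dist y q < d \<Longrightarrow> f y \<le> f q"
    by (auto simp: eventually_at)
  define y where "y = min c (q + d/2)"
  have "q < y" "y \<le> c" "dist y q < d" using d(1) assms(1) by (auto simp: y_def dist_real_def min_def)
  moreover from this have "y \<in> S" using assms(2) by auto
  ultimately show False using d(2)[of y] assms(3)[of y] by auto
qed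

text \<open>Near c the strict inequalities persist, so the first bound is the rising branch d e^q
  and the second the falling branch x' e^-q. The former controls f to the left of c, the latter to
  the right.\<close>

lemma local_max_at_crossing:
  fixes x d x' d' c :: real
  assumes "c \<in> S" "0 \<le> d" "0 \<le> x'"
    and "x * exp (- c) < d * exp c" "d' * exp c < x' * exp (- c)"
    and "\<And>q. q \<in> S \<Longrightarrow> f q \<le> max (x * exp (- q)) (d * exp q)"
    and "\<And>q. q \<in> S \<Longrightarrow> f q \<le> max (x' * exp (- q)) (d' * exp q)"
    and "d * exp c \<le> f c" "x' * exp (- c) \<le> f c"
  shows "c \<in> local_maxima_on S f"
proof -
  have "((\<lambda>q. x * exp (- q)) \<longlongrightarrow> x * exp (- c)) (at c within S)"
       "((\<lambda>q. d * exp q) \<longlongrightarrow> d * exp c) (at c within S)"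
       "((\<lambda>q. x' * exp (- q)) \<longlongrightarrow> x' * exp (- c)) (at c within S)"
       "((\<lambda>q. d' * exp q) \<longlongrightarrow> d' * exp c) (at c within S)"
    by (auto intro!: tendsto_eq_intros)
  note lim = this
  have 1: "\<forall>\<^sub>F q in at c within S. 0 < d * exp q - x * exp (- q)"
    by (rule order_tendstoD(1)[OF tendsto_diff[OF lim(2,1)]]) (use assms in simp)
  have 2: "\<forall>\<^sub>F q in at c within S. 0 < x' * exp (- q) - d' * exp q"
    by (rule order_tendstoD(1)[OF tendsto_diff[OF lim(3,4)]]) (use assms in simp)
  have "\<forall>\<^sub>F q in at c within S. q \<in> S" by (simp add: eventually_at_filter)
  with 1 2 have "\<forall>\<^sub>F q in at c within S. f q \<le> f c"
  proof eventually_elim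
    case (elim q)
    show ?case
    proof (cases "q \<le> c")
      case True
      then have "d * exp q \<le> d * exp c" using assms(2) by (intro mult_left_mono) auto
      then show ?thesis using assms(6)[OF elim(3)] elim(1) assms(8) by linarith
    next
      case False
      then have "x' * exp (- q) \<le> x' * exp (- c)" using assms(3) by (intro mult_left_mono) auto
      then show ?thesis using assms(7)[OF elim(3)] elim(2) assms(9) by linarith
    qed
  qed
  then show ?thesis using assms(1) by (simp add: local_maxima_on_def)
qed

lemma crossing_mono:
  fixes x d p q :: real
  assumes "p \<le> q" "0 \<le> x" "0 \<le> d"
  shows "x * exp (- p) \<le> d * exp p \<Longrightarrow> x * exp (- q) \<le> d * exp q"
    and "d * exp q \<le> x * exp (- q) \<Longrightarrow> d * exp p \<le> x * exp (- p)"
proof -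
  have "x * exp (- q) \<le> x * exp (- p)" "d * exp p \<le> d * exp q"
    using assms by (auto intro!: mult_left_mono)
  then show "x * exp (- p) \<le> d * exp p \<Longrightarrow> x * exp (- q) \<le> d * exp q"
    and "d * exp q \<le> x * exp (- q) \<Longrightarrow> d * exp p \<le> x * exp (- p)" by linarith+
qed

text \<open>Locates q in a gap between consecutive points. The gap before \<open>c 0\<close> is k =
  0; for finite K the gap after the last point is k = K, hence the weak bound on k.\<close>

lemma ex_crossing_index:
  fixes c :: "nat \<Rightarrow> real"
  assumes mono: "strict_mono_on {k. enat k < K} c"
    and unb: "K = \<infinity> \<Longrightarrow> \<exists>k. q < c k"
    and nc: "q \<notin> c ` {k. enat k < K}"
  obtains k where "enat k \<le> K" "\<And>j. k = Suc j \<Longrightarrow> c j < q" "enat k < K \<Longrightarrow> q < c k"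
proof (cases "\<exists>k. enat k < K \<and> q < c k")
  case True
  define k where "k = (LEAST k. enat k < K \<and> q < c k)"
  have k: "enat k < K \<and> q < c k" unfolding k_def using True by (rule LeastI_ex)
  have "c j < q" if "k = Suc j" for j
  proof -
    have jK: "enat j < K" using k that by (metis Suc_ile_eq less_imp_le)
    have "\<not> (enat j < K \<and> q < c j)" 
      using not_less_Least[of j "\<lambda>k. enat k < K \<and> q < c k"] that unfolding k_def by simp
    with jK nc show ?thesis by (force simp: not_less)
  qed
  with k that[of k] show ?thesis by auto
next
  case False
  then obtain N where N: "K = enat N" using unb by (cases K) auto
  have "c j < q" if j: "N = Suc j" for j
  proof -
    have jK: "enat j < K" using N j by simp
    then have "c j \<le> q" using False by (meson not_less)
    moreover have "c j \<noteq> q" using nc jK by blast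
    ultimately show ?thesis by simp
  qed
  with that[of N] N show ?thesis by auto
qed

text \<open>Stated abstractly so that it serves both minima. \<open>upper\<close> and
  \<open>lower\<close> squeeze f onto an envelope that rises before each crossing and falls after
  it; \<open>left\<close> and \<open>right\<close> exclude further maxima before the first and after
  the last crossing. For infinite K, \<open>unb\<close> puts every q before some crossing.\<close>

lemma local_maxima_on_eq_crossings:
  fixes X D c :: "nat \<Rightarrow> real"
  assumes S: "\<And>a b. a \<in> S \<Longrightarrow> b \<in> S \<Longrightarrow> {a..b} \<subseteq> S"
    and K0: "0 < K"
    and X0: "0 \<le> X 0"
    and D: "\<And>k. 0 \<le> D k"
    and Xinc: "\<And>k. enat k < K \<Longrightarrow> X k < X (Suc k)"
    and Ddec: "\<And>k. enat k < K \<Longrightarrow> D (Suc k) < D k"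
    and cS: "\<And>k. enat k < K \<Longrightarrow> c k \<in> S"
    and cross: "\<And>k. enat k < K \<Longrightarrow> X (Suc k) * exp (- c k) = D k * exp (c k)"
    and unb: "\<And>q. K = \<infinity> \<Longrightarrow> \<exists>k. q < c k"
    and upper: "\<And>k q. enat k \<le> K \<Longrightarrow> q \<in> S \<Longrightarrow> f q \<le> max (X k * exp (- q)) (D k * exp q)"
    and lower: "\<And>k q. enat k < K \<Longrightarrow> q \<in> S \<Longrightarrow> min (X (Suc k) * exp (- q)) (D k * exp q) \<le> f q"
    and left: "\<And>q. q \<in> S \<Longrightarrow> q < c 0 \<Longrightarrow> X 0 * exp (- q) \<le> D 0 * exp q"
    and right: "\<And>q N. K = enat (Suc N) \<Longrightarrow> q \<in> S \<Longrightarrow> c N < q \<Longrightarrow>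
                  D (Suc N) * exp q \<le> X (Suc N) * exp (- q)"
  shows "strict_mono_on {k. enat k < K} c"
    and "local_maxima_on S f = c ` {k. enat k < K}"
proof -
  have Xpos: "0 \<le> X k" if "enat k \<le> K" for k
    using that
  proof (induction k)
    case 0 show ?case by (rule X0)
  next
    case (Suc k)
    then have "enat k < K" by (simp add: Suc_ile_eq)
    with Suc.IH Xinc[of k] show ?case by (simp add: less_imp_le)
  qed
  \<comment> \<open>If \<open>c (Suc k)\<close> came no later than \<open>c k\<close>, the rising
    branch of \<open>Suc k\<close> would lie strictly below the falling branch of
    \<open>Suc (Suc k)\<close> at \<open>c (Suc k)\<close>, so they could not meet there.\<close>
  have step: "c k < c (Suc k)" if "enat (Suc k) < K" for k
  proof (rule ccontr)
    assume "\<not> c k < c (Suc k)"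
    then have le: "c (Suc k) \<le> c k" by simp
    have kK: "enat k < K" using that by (meson Suc_ile_eq less_imp_le)
    have "D (Suc k) * exp (c (Suc k)) \<le> D (Suc k) * exp (c k)"
      using le D by (intro mult_left_mono) auto
    also have "\<dots> < D k * exp (c k)" using Ddec[OF kK] by simp
    also have "\<dots> = X (Suc k) * exp (- c k)" using cross[OF kK] by simp
    also have "\<dots> \<le> X (Suc k) * exp (- c (Suc k))"
      using le Xpos that by (intro mult_left_mono) auto
    also have "\<dots> < X (Suc (Suc k)) * exp (- c (Suc k))" using Xinc[OF that] by simp
    finally show False using cross[OF that] by simp
  qed
  have less: "c j < c k" if "j < k" "enat k < K" for j k
    using that
  proof (induction k)
    case (Suc k)
    have "enat k < K" using Suc.prems by (meson Suc_ile_eq less_imp_le)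
    with Suc step[of k] show ?case by (cases "j = k") force+
  qed simp
  show mono: "strict_mono_on {k. enat k < K} c"
    by (rule strict_mono_onI) (auto intro: less)
  show "local_maxima_on S f = c ` {k. enat k < K}"
  proof (intro equalityI subsetI)
    fix q assume "q \<in> c ` {k. enat k < K}"
    then obtain k where k: "enat k < K" "q = c k" by auto
    have k': "enat (Suc k) \<le> K" using k by (simp add: Suc_ile_eq)
    have "X k * exp (- c k) < X (Suc k) * exp (- c k)" "D (Suc k) * exp (c k) < D k * exp (c k)"
      using Xinc[OF k(1)] Ddec[OF k(1)] by simp_all
    then show "q \<in> local_maxima_on S f" unfolding k(2)
      by (intro local_max_at_crossing[of "c k" S "D k" "X (Suc k)" "X k" "D (Suc k)"])
        (use cS[OF k(1)] D Xpos[OF k'] cross[OF k(1)] upper[OF less_imp_le[OF k(1)]] upper[OF k']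
          lower[OF k(1) cS[OF k(1)]] in auto)
  next
    fix q assume q: "q \<in> local_maxima_on S f"
    then have qS: "q \<in> S" by (simp add: local_maxima_on_def)
    show "q \<in> c ` {k. enat k < K}"
    proof (rule ccontr)
      assume "q \<notin> c ` {k. enat k < K}"
      then obtain k where k: "enat k \<le> K" "\<And>j. k = Suc j \<Longrightarrow> c j < q" "enat k < K \<Longrightarrow> q < c k"
        using ex_crossing_index[OF mono unb, of q] by metis
      \<comment> \<open>At q the function is at most the falling branch of k, while on all of [c j,
        q) it is at least that branch, which is strictly larger further left.\<close>
      have descending: False if j: "k = Suc j" and le: "D k * exp q \<le> X k * exp (- q)" for j
      proof -
        have jK: "enat j < K" using k(1) j by (simp add: Suc_ile_eq)
        have Xk: "0 < X k" using Xinc[OF jK] Xpos[OF less_imp_le[OF jK]] j by simp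
        have "f q < f y" if "c j \<le> y" "y < q" for y
        proof -
          have yS: "y \<in> S" using S[OF cS[OF jK] qS] that by auto
          have "X k * exp (- y) \<le> D j * exp y"
            using crossing_mono(1)[OF that(1), of "X k" "D j"] cross[OF jK] Xk D j by simp
          then have "X k * exp (- y) \<le> f y" using lower[OF jK yS] j by simp
          moreover have "X k * exp (- q) < X k * exp (- y)" using Xk that by simp
          ultimately show ?thesis using upper[OF k(1) qS] le by simp
        qed
        then have "q \<notin> local_maxima_on S f"
          using not_local_max_left[of "c j" q S f] k(2)[OF j] S[OF cS[OF jK] qS] by blast
        with q show False by blast
      qed
      \<comment> \<open>Mirror image: from q up to \<open>c k\<close> the function stays above the
        rising branch of k, strictly increasing because \<open>D k\<close> is positive.\<close>
      have ascending: False if kK: "enat k < K" and le: "X k * exp (- q) \<le> D k * exp q"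
      proof -
        have Dk: "0 < D k" using Ddec[OF kK] D[of "Suc k"] by simp
        have Xk: "0 \<le> X (Suc k)" using Xpos kK by (simp add: Suc_ile_eq)
        have "f q < f y" if "q < y" "y \<le> c k" for y
        proof -
          have yS: "y \<in> S" using S[OF qS cS[OF kK]] that by auto
          have "D k * exp y \<le> X (Suc k) * exp (- y)"
            using crossing_mono(2)[OF that(2), of "X (Suc k)" "D k"] cross[OF kK] Xk D by simp
          then have "D k * exp y \<le> f y" using lower[OF kK yS] by simp
          moreover have "D k * exp q < D k * exp y" using Dk that by simp
          ultimately show ?thesis using upper[OF k(1) qS] le by simp
        qed
        then have "q \<notin> local_maxima_on S f"
          using not_local_max_right[of q "c k" S f] k(3)[OF kK] S[OF qS cS[OF kK]] by blast
        with q show False by blast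
      qed
      show False
      proof (cases k)
        case 0
        with ascending left[OF qS] k(3) K0 show False by (simp add: zero_enat_def)
      next
        case (Suc j)
        show False
        proof (cases "enat k < K")
          case True
          with ascending descending[OF Suc] show False by linarith
        next
          case False
          then have "K = enat (Suc j)" using k(1) Suc by simp
          from right[OF this qS k(2)[OF Suc]] descending[OF Suc] Suc show False by simp
        qed
      qed
    qed
  qed
qed

subsection \<open>Successive minima\<close>

definition linear_form :: "real \<Rightarrow> real \<times> real \<Rightarrow> real" where
  "linear_form \<xi> p = fst p * \<xi> - snd p"

definition body_gauge :: "real \<Rightarrow> real \<Rightarrow> real \<times> real \<Rightarrow> real" where
  "body_gauge \<xi> q p = max (\<bar>fst p\<bar> * exp (- q)) (\<bar>linear_form \<xi> p\<bar> * exp q)"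

definition det2 :: "real \<times> real \<Rightarrow> real \<times> real \<Rightarrow> real" where
  "det2 p r = fst p * snd r - snd p * fst r"

lemma body_gauge_nonneg: "0 \<le> body_gauge \<xi> q p"
  by (auto simp: body_gauge_def le_max_iff_disj)

lemma body_gauge_pos:
  assumes "p \<noteq> 0"
  shows "0 < body_gauge \<xi> q p"
proof -
  have "fst p \<noteq> 0 \<or> linear_form \<xi> p \<noteq> 0"
    using assms by (auto simp: linear_form_def prod_eq_iff)
  then show ?thesis by (auto simp: body_gauge_def less_max_iff_disj)
qed

lemma scaled_convex_body:
  assumes "0 \<le> l"
  shows "(\<lambda>p. l *\<^sub>R p) ` convex_body \<xi> (exp q) = {p. body_gauge \<xi> q p \<le> l}"
proof (intro equalityI subsetI)
  fix p assume "p \<in> (\<lambda>p. l *\<^sub>R p) ` convex_body \<xi> (exp q)"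
  then obtain r where "p = l *\<^sub>R r" "r \<in> convex_body \<xi> (exp q)" by blast
  then have r: "p = l *\<^sub>R r" "\<bar>fst r\<bar> \<le> exp q" "\<bar>linear_form \<xi> r\<bar> \<le> exp (- q)"
    by (auto simp: convex_body_def linear_form_def exp_minus inverse_eq_divide)
  have "\<bar>fst r\<bar> * exp (- q) \<le> 1" "\<bar>linear_form \<xi> r\<bar> * exp q \<le> 1"
    using r(2,3) by (simp_all add: exp_minus field_simps)
  then have "l * (\<bar>fst r\<bar> * exp (- q)) \<le> l * 1" "l * (\<bar>linear_form \<xi> r\<bar> * exp q) \<le> l * 1"
    using assms by (intro mult_left_mono; simp)+
  moreover have "linear_form \<xi> p = l * linear_form \<xi> r"
    by (simp add: r(1) linear_form_def algebra_simps)
  ultimately show "p \<in> {p. body_gauge \<xi> q p \<le> l}"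
    using assms by (simp add: r(1) body_gauge_def abs_mult)
next
  fix p assume "p \<in> {p. body_gauge \<xi> q p \<le> l}"
  then have p: "\<bar>fst p\<bar> * exp (- q) \<le> l" "\<bar>linear_form \<xi> p\<bar> * exp q \<le> l" "body_gauge \<xi> q p \<le> l"
    by (auto simp: body_gauge_def)
  show "p \<in> (\<lambda>p. l *\<^sub>R p) ` convex_body \<xi> (exp q)"
  \<comment> \<open>Rescaling by 1/l fails for l = 0; there definiteness of the gauge leaves only
    the origin.\<close>
  proof (cases "l = 0")
    case True
    then have "p = 0" using body_gauge_pos[of p \<xi> q] p(3) by force
    moreover have "0 \<in> convex_body \<xi> (exp q)" by (simp add: convex_body_def zero_prod_def)
    ultimately show ?thesis by force
  next
    case False
    have "fst p / l * \<xi> - snd p / l = linear_form \<xi> p / l"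
      by (simp add: linear_form_def diff_divide_distrib)
    then have "p /\<^sub>R l \<in> convex_body \<xi> (exp q)"
      using p(1,2) False assms
      by (auto simp: convex_body_def scaleR_prod_def abs_mult exp_minus field_simps linear_form_def)
    then show ?thesis using False by (intro image_eqI[of _ _ "p /\<^sub>R l"]) auto
  qed
qed

lemma succ_min_eq_gauge:
  "succ_min j (convex_body \<xi> (exp q)) =
     (LEAST l. 0 \<le> l \<and> (\<exists>S \<subseteq> int_lattice. independent S \<and> card S = j \<and> (\<forall>p\<in>S. body_gauge \<xi> q p \<le> l)))"
proof -
  have "(0 \<le> l \<and> (\<exists>S. S \<subseteq> (\<lambda>p. l *\<^sub>R p) ` convex_body \<xi> (exp q) \<inter> int_lattice \<and> independent S \<and> card S = j)) \<longleftrightarrow>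
    (0 \<le> l \<and> (\<exists>S \<subseteq> int_lattice. independent S \<and> card S = j \<and> (\<forall>p\<in>S. body_gauge \<xi> q p \<le> l)))" for l
    using scaled_convex_body[of l \<xi> q] by (cases "0 \<le> l") (simp, blast, simp)
  then show ?thesis unfolding succ_min_def by presburger
qed

text \<open>This finiteness makes the successive minima attained. The gauge bounds x directly, and y
  as the difference of x xi and the linear form.\<close>

lemma finite_int_lattice_gauge: "finite {p \<in> int_lattice. body_gauge \<xi> q p \<le> B}"
proof -
  define b where "b = \<bar>B * exp q\<bar> * (1 + \<bar>\<xi>\<bar>) + \<bar>B * exp (- q)\<bar>"
  let ?I = "{i \<in> \<int>. - b \<le> i \<and> i \<le> b}"
  have "{p \<in> int_lattice. body_gauge \<xi> q p \<le> B} \<subseteq> ?I \<times> ?I"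
  proof
    fix p assume "p \<in> {p \<in> int_lattice. body_gauge \<xi> q p \<le> B}"
    then have p: "fst p \<in> \<int>" "snd p \<in> \<int>" "\<bar>fst p\<bar> * exp (- q) \<le> B" "\<bar>linear_form \<xi> p\<bar> * exp q \<le> B"
      by (auto simp: int_lattice_def body_gauge_def)
    have 1: "\<bar>fst p\<bar> \<le> \<bar>B * exp q\<bar>" "\<bar>linear_form \<xi> p\<bar> \<le> \<bar>B * exp (- q)\<bar>"
      using p(3,4) by (auto simp: exp_minus field_simps)
    have 2: "\<bar>fst p * \<xi>\<bar> \<le> \<bar>B * exp q\<bar> * \<bar>\<xi>\<bar>"
      unfolding abs_mult[of "fst p"] using 1(1) by (intro mult_right_mono) auto
    have "snd p = fst p * \<xi> - linear_form \<xi> p" by (simp add: linear_form_def)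
    then have "\<bar>snd p\<bar> \<le> b" using 1 2 unfolding b_def distrib_left mult_1_right by linarith
    moreover have "\<bar>fst p\<bar> \<le> b" using 1(1) by (auto simp: b_def distrib_left add.assoc intro: add_increasing2)
    ultimately show "p \<in> ?I \<times> ?I" using p(1,2) by (auto simp: mem_Times_iff)
  qed
  then show ?thesis by (rule finite_subset) (intro finite_cartesian_product finite_int_segment)
qed

text \<open>\<open>LEAST\<close> over the reals is informative only if a minimum exists. Every
  admissible l up to b can be lowered to an admissible element of the finite set G, so the least of
  those is the minimum.\<close>

lemma ex_least_real:
  fixes P :: "real \<Rightarrow> bool"
  assumes "P b" "finite G" "\<And>l. l \<le> b \<Longrightarrow> P l \<Longrightarrow> \<exists>l'\<in>G. l' \<le> l \<and> P l'"
  shows "P (Least P)" "P l \<Longrightarrow> Least P \<le> l"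
proof -
  define H where "H = {l \<in> G. P l}"
  have H: "finite H" "H \<noteq> {}" using assms by (auto simp: H_def)
  have min: "Min H \<le> l" if Pl: "P l" for l
  proof (cases "l \<le> b")
    case True
    then obtain l' where "l' \<in> H" "l' \<le> l" using assms(3)[of l] Pl by (auto simp: H_def)
    then show ?thesis using Min_le[OF H(1)] by fastforce
  next
    case False
    obtain l' where "l' \<in> H" "l' \<le> b" using assms(3)[of b] assms(1) by (auto simp: H_def)
    then show ?thesis using Min_le[OF H(1)] False by fastforce
  qed
  have "P (Min H)" using Min_in[OF H] by (simp add: H_def)
  then have "Least P = Min H" using min by (intro Least_equality)
  with min \<open>P (Min H)\<close> show "P (Least P)" "P l \<Longrightarrow> Least P \<le> l" by auto
qed

text \<open>The largest gauge on T is a first admissible value. Any admissible l can be lowered to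
  the largest gauge on its set S, which is the gauge of a lattice point, and only finitely many of
  these lie below the first value. \<open>0 < j\<close> makes S finite and nonempty, since infinite
  sets have \<open>card\<close> 0.\<close>

lemma
  fixes T :: "(real \<times> real) set"
  assumes T: "T \<subseteq> int_lattice" "independent T" "card T = j" and j: "0 < j"
  shows succ_min_attained: "\<exists>S \<subseteq> int_lattice. independent S \<and> card S = j \<and>
           (\<forall>p\<in>S. body_gauge \<xi> q p \<le> succ_min j (convex_body \<xi> (exp q)))"
    and succ_min_le: "(\<And>p. p \<in> T \<Longrightarrow> body_gauge \<xi> q p \<le> l) \<Longrightarrow>
           succ_min j (convex_body \<xi> (exp q)) \<le> l"
proof -
  define P where "P l \<longleftrightarrow> 0 \<le> l \<and>
    (\<exists>S \<subseteq> int_lattice. independent S \<and> card S = j \<and> (\<forall>p\<in>S. body_gauge \<xi> q p \<le> l))" for l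
  have fin: "finite S" "S \<noteq> {}" if "card S = j" for S :: "(real \<times> real) set"
    using that j by (auto intro: card_ge_0_finite)
  define b where "b = Max (body_gauge \<xi> q ` T)"
  have b: "body_gauge \<xi> q p \<le> b" if "p \<in> T" for p
    using that fin[OF T(3)] by (simp add: b_def)
  have b0: "0 \<le> b" using b fin(2)[OF T(3)] body_gauge_nonneg order_trans by blast
  have Pb: "P b" unfolding P_def using T b b0 by blast
  define G where "G = body_gauge \<xi> q ` {p \<in> int_lattice. body_gauge \<xi> q p \<le> b}"
  have G: "finite G" by (simp add: G_def finite_int_lattice_gauge)
  have red: "\<exists>l'\<in>G. l' \<le> l \<and> P l'" if l: "l \<le> b" "P l" for l
  proof -
    obtain S where S: "S \<subseteq> int_lattice" "independent S" "card S = j" "\<forall>p\<in>S. body_gauge \<xi> q p \<le> l"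
      using l(2) by (auto simp: P_def)
    define l' where "l' = Max (body_gauge \<xi> q ` S)"
    have "l' \<in> body_gauge \<xi> q ` S" unfolding l'_def using fin[OF S(3)] by (intro Max_in) auto
    then obtain p where p: "p \<in> S" "l' = body_gauge \<xi> q p" by auto
    have "body_gauge \<xi> q r \<le> l'" if "r \<in> S" for r using that fin[OF S(3)] by (simp add: l'_def)
    then have "P l'" unfolding P_def using S p body_gauge_nonneg by blast
    moreover have "l' \<le> l" "l' \<in> G" using p S l(1) by (force simp: G_def)+
    ultimately show ?thesis by blast
  qed
  note least = ex_least_real[of P, OF Pb G red]
  have eq: "succ_min j (convex_body \<xi> (exp q)) = Least P"
    unfolding succ_min_eq_gauge P_def ..
  show "\<exists>S \<subseteq> int_lattice. independent S \<and> card S = j \<and>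
           (\<forall>p\<in>S. body_gauge \<xi> q p \<le> succ_min j (convex_body \<xi> (exp q)))"
    unfolding eq using least(1) by (auto simp: P_def)
  show "succ_min j (convex_body \<xi> (exp q)) \<le> l" if "\<And>p. p \<in> T \<Longrightarrow> body_gauge \<xi> q p \<le> l"
  proof -
    have "0 \<le> l" using that fin(2)[OF T(3)] body_gauge_nonneg order_trans by blast
    with T that have "P l" unfolding P_def by blast
    then show ?thesis unfolding eq by (intro least(2))
  qed
qed

lemma independent_pair_if_det2:
  assumes "det2 p r \<noteq> 0"
  shows "independent {p, r}" "card {p, r} = 2"
proof -
  have ne: "p \<noteq> r" using assms by (auto simp: det2_def)
  then show "card {p, r} = 2" by simp
  have r0: "r \<noteq> 0" using assms by (auto simp: det2_def)
  have "p \<notin> span {r}"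
  proof
    assume "p \<in> span {r}"
    then obtain k where "p = k *\<^sub>R r" by (auto simp: span_singleton)
    then show False using assms by (simp add: det2_def)
  qed
  then show "independent {p, r}" using r0 ne by (simp add: independent_insert)
qed

text \<open>Otherwise S would lie on the line of v. This supplies the point off that line to which
  the lower bounds for the second minimum apply.\<close>

lemma independent_pair_ex_det2:
  fixes S :: "(real \<times> real) set"
  assumes "independent S" "card S = 2" "v \<noteq> 0"
  shows "\<exists>p\<in>S. det2 v p \<noteq> 0"
proof (rule ccontr)
  assume not_ex: "\<not> ?thesis"
  have "p \<in> span {v}" if "p \<in> S" for p
  proof -
    have d: "fst v * snd p = snd v * fst p" using not_ex that by (simp add: det2_def)
    have "p = (if fst v \<noteq> 0 then fst p / fst v else snd p / snd v) *\<^sub>R v"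
      using d assms(3) by (auto simp: prod_eq_iff field_simps)
    then show ?thesis by (auto simp: span_singleton)
  qed
  then have "S \<subseteq> span {v}" by auto
  then have "card S \<le> card {v}"
    using independent_span_bound[of "{v}" S] assms(1) by auto
  with assms(2) show False by simp
qed

lemma succ_min_1_le:
  assumes "p \<in> int_lattice" "p \<noteq> 0"
  shows "succ_min 1 (convex_body \<xi> (exp q)) \<le> body_gauge \<xi> q p"
  by (rule succ_min_le[of "{p}"]) (use assms in auto)

lemma succ_min_1_attained:
  "\<exists>p\<in>int_lattice. p \<noteq> 0 \<and> body_gauge \<xi> q p \<le> succ_min 1 (convex_body \<xi> (exp q))"
proof -
  have "\<exists>S \<subseteq> int_lattice. independent S \<and> card S = 1 \<and>
           (\<forall>p\<in>S. body_gauge \<xi> q p \<le> succ_min 1 (convex_body \<xi> (exp q)))"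
    by (rule succ_min_attained[of "{(1, 0)}"]) (auto simp: int_lattice_def zero_prod_def)
  then obtain p where "{p} \<subseteq> int_lattice" "independent {p}"
    "body_gauge \<xi> q p \<le> succ_min 1 (convex_body \<xi> (exp q))" by (auto simp: card_1_singleton_iff)
  then show ?thesis by auto
qed

lemma succ_min_2_le:
  assumes "p \<in> int_lattice" "r \<in> int_lattice" "det2 p r \<noteq> 0"
  shows "succ_min 2 (convex_body \<xi> (exp q)) \<le> max (body_gauge \<xi> q p) (body_gauge \<xi> q r)"
  by (rule succ_min_le[of "{p, r}"]) (use assms independent_pair_if_det2[OF assms(3)] in auto)

lemma succ_min_2_attained:
  assumes "v \<noteq> 0"
  shows "\<exists>p\<in>int_lattice. det2 v p \<noteq> 0 \<and> body_gauge \<xi> q p \<le> succ_min 2 (convex_body \<xi> (exp q))"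
proof -
  have "det2 (1, 0) (0, 1) \<noteq> 0" by (simp add: det2_def)
  note ind = independent_pair_if_det2[OF this]
  have "\<exists>S \<subseteq> int_lattice. independent S \<and> card S = 2 \<and>
           (\<forall>p\<in>S. body_gauge \<xi> q p \<le> succ_min 2 (convex_body \<xi> (exp q)))"
    by (rule succ_min_attained[of "{(1, 0), (0, 1)}"]) (use ind in \<open>auto simp: int_lattice_def\<close>)
  then show ?thesis using independent_pair_ex_det2[OF _ _ assms] by blast
qed

lemma succ_min_pos:
  assumes "j \<in> {1, 2}"
  shows "0 < succ_min j (convex_body \<xi> (exp q))"
proof -
  have "\<exists>p. p \<noteq> 0 \<and> body_gauge \<xi> q p \<le> succ_min 1 (convex_body \<xi> (exp q))"
    using succ_min_1_attained by blast
  moreover have "\<exists>p. p \<noteq> 0 \<and> body_gauge \<xi> q p \<le> succ_min 2 (convex_body \<xi> (exp q))"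
  proof -
    have "(1, 0) \<noteq> (0 :: real \<times> real)" by (simp add: zero_prod_def)
    from succ_min_2_attained[OF this, of \<xi> q] obtain p where
      p: "det2 (1, 0) p \<noteq> 0" "body_gauge \<xi> q p \<le> succ_min 2 (convex_body \<xi> (exp q))" by blast
    from p(1) have "p \<noteq> 0" by (auto simp: det2_def)
    with p(2) show ?thesis by blast
  qed
  ultimately show ?thesis using assms body_gauge_pos by (blast intro: less_le_trans)
qed

lemma local_maxima_on_L:
  assumes "j \<in> {1, 2}"
  shows "local_maxima_on S (L \<xi> j) = local_maxima_on S (\<lambda>q. succ_min j (convex_body \<xi> (exp q)))"
  unfolding local_maxima_on_def L_def using succ_min_pos[OF assms] by simp

section \<open>Invariance under a sign change and integer translation of xi\<close>

lemma lattice_gauge_transfer: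
  fixes r :: int
  assumes \<epsilon>: "\<epsilon> \<in> {1, -1 :: real}" and \<eta>: "\<eta> = \<epsilon> * \<xi> + of_int r"
    and "\<exists>S \<subseteq> int_lattice. independent S \<and> card S = j \<and> (\<forall>p\<in>S. body_gauge \<xi> q p \<le> l)"
  shows "\<exists>S \<subseteq> int_lattice. independent S \<and> card S = j \<and> (\<forall>p\<in>S. body_gauge \<eta> q p \<le> l)"
proof -
  \<comment> \<open>A sign change combined with a shear: it maps the lattice into itself, fixes x
    and alters the linear form only by the sign, hence preserves gauges.\<close>
  define h where "h p = (fst p, \<epsilon> * snd p + of_int r * fst p)" for p :: "real \<times> real"
  obtain S where S: "S \<subseteq> int_lattice" "independent S" "card S = j" "\<forall>p\<in>S. body_gauge \<xi> q p \<le> l"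
    using assms(3) by blast
  have lin: "linear h" by (rule linearI) (auto simp: h_def algebra_simps)
  have inj: "inj h" using \<epsilon> by (auto simp: inj_def h_def prod_eq_iff)
  have "h ` S \<subseteq> int_lattice" using S(1) \<epsilon> by (auto simp: int_lattice_def h_def)
  moreover have "independent (h ` S)"
    using linear_independent_injective_image[OF lin S(2)] inj by (meson inj_on_subset subset_UNIV)
  moreover have "card (h ` S) = j" using S(3) card_image inj by (metis inj_on_subset subset_UNIV)
  moreover have "body_gauge \<eta> q (h p) = body_gauge \<xi> q p" for p
  proof -
    have "linear_form \<eta> (h p) = \<epsilon> * linear_form \<xi> p"
      by (simp add: \<eta> linear_form_def h_def algebra_simps)
    then show ?thesis using \<epsilon> by (auto simp: body_gauge_def h_def abs_mult)
  qed
  ultimately show ?thesis using S(4) by (intro exI[of _ "h ` S"]) auto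
qed

lemma L_dist_int: "L (dist_int \<xi>) j = L \<xi> j"
proof -
  obtain \<epsilon> :: real where \<epsilon>: "\<epsilon> \<in> {1, -1}" "dist_int \<xi> = \<epsilon> * (\<xi> - of_int (round \<xi>))"
    unfolding dist_int_def by (cases "0 \<le> \<xi> - of_int (round \<xi>)") force+
  obtain e :: int where e: "\<epsilon> = of_int e" using \<epsilon>(1) by (metis insertE of_int_1 of_int_minus singletonD)
  have 1: "dist_int \<xi> = \<epsilon> * \<xi> + of_int (- e * round \<xi>)" using \<epsilon> e by (simp add: algebra_simps)
  \<comment> \<open>Since the sign squares to 1, the relation inverts to the same shape, and one
    transfer lemma gives both directions.\<close>
  have 2: "\<xi> = \<epsilon> * dist_int \<xi> + of_int (round \<xi>)" using \<epsilon> by auto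
  have "(\<exists>S \<subseteq> int_lattice. independent S \<and> card S = j \<and> (\<forall>p\<in>S. body_gauge (dist_int \<xi>) q p \<le> l)) \<longleftrightarrow>
    (\<exists>S \<subseteq> int_lattice. independent S \<and> card S = j \<and> (\<forall>p\<in>S. body_gauge \<xi> q p \<le> l))" for q l
    by (rule iffI; erule lattice_gauge_transfer[OF \<epsilon>(1) 1] lattice_gauge_transfer[OF \<epsilon>(1) 2])
  then show ?thesis unfolding L_def succ_min_eq_gauge by simp
qed

subsection \<open>Lower bounds from unimodular bases\<close>

text \<open>The weak inequalities admit the initial vector (0, 1), whose first coordinate is 0, and
  a last convergent with vanishing linear form.\<close>

definition adapted_basis :: "real \<Rightarrow> real \<times> real \<Rightarrow> real \<times> real \<Rightarrow> bool" where
  "adapted_basis \<theta> u w \<longleftrightarrow> u \<in> int_lattice \<and> w \<in> int_lattice \<and> \<bar>det2 u w\<bar> = 1 \<and>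
     0 \<le> fst u \<and> 0 \<le> fst w \<and> linear_form \<theta> u * linear_form \<theta> w \<le> 0"

lemma adapted_basis_nonzero:
  assumes "adapted_basis \<theta> u w"
  shows "u \<noteq> 0" "w \<noteq> 0"
  using assms by (auto simp: adapted_basis_def det2_def)

lemma adapted_basis_coordinates:
  assumes "adapted_basis \<theta> u w" "p \<in> int_lattice"
  obtains a b where "a \<in> \<int>" "b \<in> \<int>" "p = a *\<^sub>R u + b *\<^sub>R w"
proof
  \<comment> \<open>Cramer's rule: the determinant is 1 or -1, so multiplying by it replaces
    dividing and the coordinates are integers.\<close>
  define \<delta> where "\<delta> = det2 u w"
  have \<delta>: "\<delta> = 1 \<or> \<delta> = -1" using assms(1) by (auto simp: adapted_basis_def \<delta>_def abs_if split: if_splits)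
  have ints: "fst u \<in> \<int>" "snd u \<in> \<int>" "fst w \<in> \<int>" "snd w \<in> \<int>" "fst p \<in> \<int>" "snd p \<in> \<int>"
    using assms by (auto simp: adapted_basis_def int_lattice_def mem_Times_iff)
  show "\<delta> * det2 p w \<in> \<int>" "\<delta> * det2 u p \<in> \<int>"
    using \<delta> ints by (auto simp: det2_def)
  have "\<delta> * \<delta> = 1" using \<delta> by auto
  moreover have "\<delta> * det2 p w * fst u + \<delta> * det2 u p * fst w = \<delta> * \<delta> * fst p"
    "\<delta> * det2 p w * snd u + \<delta> * det2 u p * snd w = \<delta> * \<delta> * snd p"
    unfolding \<delta>_def det2_def by algebra+
  ultimately show "p = (\<delta> * det2 p w) *\<^sub>R u + (\<delta> * det2 u p) *\<^sub>R w"
    by (simp add: prod_eq_iff)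
qed

lemma linear_form_add_scaleR:
  "linear_form \<theta> (a *\<^sub>R u + b *\<^sub>R w) = a * linear_form \<theta> u + b * linear_form \<theta> w"
  by (simp add: linear_form_def algebra_simps)

lemma abs_add_same_sign:
  fixes x y :: real
  assumes "0 \<le> x * y"
  shows "\<bar>x + y\<bar> = \<bar>x\<bar> + \<bar>y\<bar>"
  using assms by (auto simp: zero_le_mult_iff)

lemma abs_fst_adapted:
  assumes "adapted_basis \<theta> u w" "0 \<le> a * b"
  shows "\<bar>fst (a *\<^sub>R u + b *\<^sub>R w)\<bar> = \<bar>a\<bar> * fst u + \<bar>b\<bar> * fst w"
proof -
  have pos: "0 \<le> fst u" "0 \<le> fst w" using assms by (auto simp: adapted_basis_def)
  have "(a * fst u) * (b * fst w) = (a * b) * (fst u * fst w)" by simp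
  also have "\<dots> \<ge> 0" by (rule mult_nonneg_nonneg[OF assms(2) mult_nonneg_nonneg[OF pos]])
  finally show ?thesis using pos by (simp add: abs_add_same_sign abs_mult)
qed

lemma abs_linear_form_adapted:
  assumes "adapted_basis \<theta> u w" "a * b \<le> 0"
  shows "\<bar>linear_form \<theta> (a *\<^sub>R u + b *\<^sub>R w)\<bar> = \<bar>a\<bar> * \<bar>linear_form \<theta> u\<bar> + \<bar>b\<bar> * \<bar>linear_form \<theta> w\<bar>"
proof -
  have "linear_form \<theta> u * linear_form \<theta> w \<le> 0" using assms by (auto simp: adapted_basis_def)
  then have "0 \<le> (a * b) * (linear_form \<theta> u * linear_form \<theta> w)"
    using assms(2) by (rule mult_nonpos_nonpos[rotated])
  then have "0 \<le> (a * linear_form \<theta> u) * (b * linear_form \<theta> w)" by (simp add: ac_simps)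
  then show ?thesis by (simp add: linear_form_add_scaleR abs_add_same_sign abs_mult)
qed

lemma le_abs_mult_add:
  fixes a x y :: real
  assumes "a \<in> \<int>" "a \<noteq> 0" "0 \<le> x" "0 \<le> y"
  shows "x \<le> \<bar>a\<bar> * x + y"
proof -
  have "1 \<le> \<bar>a\<bar>" using assms Ints_nonzero_abs_ge1 by blast
  then have "1 * x \<le> \<bar>a\<bar> * x" using assms by (intro mult_right_mono)
  with assms show ?thesis by simp
qed

lemma body_gauge_ge:
  "x \<le> \<bar>fst p\<bar> \<Longrightarrow> min (x * exp (- q)) y \<le> body_gauge \<theta> q p"
  "d \<le> \<bar>linear_form \<theta> p\<bar> \<Longrightarrow> min y (d * exp q) \<le> body_gauge \<theta> q p"
  by (auto simp: body_gauge_def min_le_iff_disj le_max_iff_disj)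

lemma body_gauge_ge_adapted:
  assumes uw: "adapted_basis \<theta> u w" and p: "p \<in> int_lattice" "p \<noteq> 0"
  shows "min (fst w * exp (- q)) (\<bar>linear_form \<theta> u\<bar> * exp q) \<le> body_gauge \<theta> q p"
proof -
  obtain a b where ab: "a \<in> \<int>" "b \<in> \<int>" "p = a *\<^sub>R u + b *\<^sub>R w"
    using adapted_basis_coordinates[OF uw p(1)] by blast
  have pos: "0 \<le> fst u" "0 \<le> fst w" using uw by (auto simp: adapted_basis_def)
  \<comment> \<open>In the first case the D add up and |a| >= 1 gives D of u; in the second the X
    add up and |b| >= 1 gives X of w. If one coefficient is 0, the case of the other one
    applies.\<close>
  consider "a \<noteq> 0" "a * b \<le> 0" | "b \<noteq> 0" "0 \<le> a * b"
    using ab(3) p(2) by (cases "a = 0"; cases "b = 0"; force)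
  then show ?thesis
  proof cases
    case 1
    have "\<bar>linear_form \<theta> u\<bar> \<le> \<bar>linear_form \<theta> p\<bar>"
      unfolding ab(3) abs_linear_form_adapted[OF uw 1(2)]
      by (rule le_abs_mult_add) (use ab 1 in auto)
    then show ?thesis by (rule body_gauge_ge)
  next
    case 2
    have "fst w \<le> \<bar>fst p\<bar>"
      unfolding ab(3) abs_fst_adapted[OF uw 2(2)] add.commute[of "\<bar>a\<bar> * _"]
      by (rule le_abs_mult_add) (use ab 2 pos in auto)
    then show ?thesis by (rule body_gauge_ge)
  qed
qed

lemma body_gauge_ge_adapted_independent:
  assumes uw: "adapted_basis \<theta> u w" and p: "p \<in> int_lattice" "det2 u p \<noteq> 0"
  shows "min ((fst u + fst w) * exp (- q)) (\<bar>linear_form \<theta> w\<bar> * exp q) \<le> body_gauge \<theta> q p"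
proof -
  obtain a b where ab: "a \<in> \<int>" "b \<in> \<int>" "p = a *\<^sub>R u + b *\<^sub>R w"
    using adapted_basis_coordinates[OF uw p(1)] by blast
  have pos: "0 \<le> fst u" "0 \<le> fst w" using uw by (auto simp: adapted_basis_def)
  \<comment> \<open>Off the line of u the coefficient of w is nonzero, which gives D of w when the D
    add up. When a b > 0 both coefficients are nonzero, whence the sum of both X.\<close>
  have b0: "b \<noteq> 0" using p(2) ab(3) by (auto simp: det2_def)
  show ?thesis
  proof (cases "a * b \<le> 0")
    case True
    have "\<bar>linear_form \<theta> w\<bar> \<le> \<bar>linear_form \<theta> p\<bar>"
      unfolding ab(3) abs_linear_form_adapted[OF uw True] add.commute[of "\<bar>a\<bar> * _"]
      by (rule le_abs_mult_add) (use ab b0 in auto)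
    then show ?thesis by (rule body_gauge_ge)
  next
    case False
    then have a0: "a \<noteq> 0" and le: "0 \<le> a * b" by auto
    have "fst u + fst w \<le> \<bar>fst p\<bar>"
      unfolding ab(3) abs_fst_adapted[OF uw le]
      using le_abs_mult_add[OF ab(1) a0 pos(1) order_refl] le_abs_mult_add[OF ab(2) b0 pos(2) order_refl]
      by simp
    then show ?thesis by (rule body_gauge_ge)
  qed
qed

text \<open>Each addition of w moves the form of u towards 0 by D of w, and the bound on k prevents
  a change of sign. Used with k the partial quotient for convergents and with smaller k for
  intermediate convergents.\<close>

lemma adapted_basis_step:
  assumes uw: "adapted_basis \<theta> u w" and k: "real k * \<bar>linear_form \<theta> w\<bar> \<le> \<bar>linear_form \<theta> u\<bar>"
  shows "adapted_basis \<theta> w (u + real k *\<^sub>R w)"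
    and "\<bar>linear_form \<theta> (u + real k *\<^sub>R w)\<bar> = \<bar>linear_form \<theta> u\<bar> - real k * \<bar>linear_form \<theta> w\<bar>"
proof -
  define x y where "x = linear_form \<theta> u" and "y = linear_form \<theta> w"
  have xy: "x * y \<le> 0" "real k * \<bar>y\<bar> \<le> \<bar>x\<bar>"
    using uw k by (auto simp: adapted_basis_def x_def y_def)
  have lf: "linear_form \<theta> (u + real k *\<^sub>R w) = x + real k * y"
    using linear_form_add_scaleR[of \<theta> 1 u "real k" w] by (simp add: x_def y_def)
  have cases: "0 \<le> x \<and> y \<le> 0 \<or> x \<le> 0 \<and> 0 \<le> y" using xy(1) by (auto simp: mult_le_0_iff)
  have "y * (x + real k * y) \<le> 0"
    using cases xy(2) by (auto simp: mult_le_0_iff)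
  moreover have "det2 w (u + real k *\<^sub>R w) = - det2 u w" by (simp add: det2_def algebra_simps)
  moreover have "u + real k *\<^sub>R w \<in> int_lattice"
    using uw by (auto simp: adapted_basis_def int_lattice_def mem_Times_iff)
  ultimately show "adapted_basis \<theta> w (u + real k *\<^sub>R w)"
    using uw lf by (simp add: adapted_basis_def y_def)
  show "\<bar>linear_form \<theta> (u + real k *\<^sub>R w)\<bar> = \<bar>linear_form \<theta> u\<bar> - real k * \<bar>linear_form \<theta> w\<bar>"
    using cases xy(2) unfolding lf by (auto simp: x_def y_def)
qed

subsection \<open>Convergents\<close>

text \<open>Indices are shifted by one: \<open>conv_vec \<theta> (n + 1)\<close> is the \<open>n\<close>-th convergent (denominator,
  numerator), and \<open>partial_quot \<theta> n\<close> below is the partial quotient \<open>a\<^sub>n\<^sub>+\<^sub>1\<close>. Once the linear form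
  vanishes, the division by zero yields quotient \<open>0\<close> and the sequence is meaningless from there on.\<close>

fun conv_vec :: "real \<Rightarrow> nat \<Rightarrow> real \<times> real" where
  "conv_vec \<theta> 0 = (0, 1)"
| "conv_vec \<theta> (Suc 0) = (1, 0)"
| "conv_vec \<theta> (Suc (Suc n)) = conv_vec \<theta> n +
     real (nat \<lfloor>\<bar>linear_form \<theta> (conv_vec \<theta> n)\<bar> / \<bar>linear_form \<theta> (conv_vec \<theta> (Suc n))\<bar>\<rfloor>) *\<^sub>R
       conv_vec \<theta> (Suc n)"

definition conv_err :: "real \<Rightarrow> nat \<Rightarrow> real" where
  "conv_err \<theta> n = \<bar>linear_form \<theta> (conv_vec \<theta> n)\<bar>"

definition partial_quot :: "real \<Rightarrow> nat \<Rightarrow> nat" where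
  "partial_quot \<theta> n = nat \<lfloor>conv_err \<theta> n / conv_err \<theta> (Suc n)\<rfloor>"

lemma conv_vec_rec:
  "conv_vec \<theta> (Suc (Suc n)) = conv_vec \<theta> n + real (partial_quot \<theta> n) *\<^sub>R conv_vec \<theta> (Suc n)"
  by (simp add: partial_quot_def conv_err_def)

declare conv_vec.simps(3) [simp del]

lemma conv_err_nonneg: "0 \<le> conv_err \<theta> n"
  by (simp add: conv_err_def)

lemma conv_err_0: "conv_err \<theta> 0 = 1"
  by (simp add: conv_err_def linear_form_def)

lemma conv_err_1: "conv_err \<theta> (Suc 0) = \<bar>\<theta>\<bar>"
  by (simp add: conv_err_def linear_form_def)

lemma partial_quot_le: "real (partial_quot \<theta> n) * conv_err \<theta> (Suc n) \<le> conv_err \<theta> n"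
proof (cases "conv_err \<theta> (Suc n) = 0")
  case False
  then have pos: "0 < conv_err \<theta> (Suc n)" using conv_err_nonneg[of \<theta> "Suc n"] by simp
  have "real (partial_quot \<theta> n) \<le> conv_err \<theta> n / conv_err \<theta> (Suc n)"
    unfolding partial_quot_def by (intro of_nat_floor) (simp add: conv_err_nonneg)
  then show ?thesis using pos by (simp add: field_simps)
qed (simp add: conv_err_nonneg)

text \<open>Valid for every n, also past the first vanishing error, where
  \<open>partial_quot_le\<close> still licenses the step.\<close>

lemma adapted_basis_conv_vec:
  assumes "0 \<le> \<theta>"
  shows "adapted_basis \<theta> (conv_vec \<theta> n) (conv_vec \<theta> (Suc n))"
proof (induction n)
  case 0
  show ?case using assms by (simp add: adapted_basis_def int_lattice_def det2_def linear_form_def)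
next
  case (Suc n)
  show ?case unfolding conv_vec_rec
    by (rule adapted_basis_step(1)[OF Suc]) (use partial_quot_le in \<open>simp add: conv_err_def\<close>)
qed

lemma conv_err_rec:
  assumes "0 \<le> \<theta>"
  shows "conv_err \<theta> (Suc (Suc n)) = conv_err \<theta> n - real (partial_quot \<theta> n) * conv_err \<theta> (Suc n)"
  unfolding conv_err_def conv_vec_rec
  by (rule adapted_basis_step(2)[OF adapted_basis_conv_vec[OF assms]])
    (use partial_quot_le in \<open>simp add: conv_err_def\<close>)

text \<open>This turns out to be s. It is one more than the number of partial quotients: theta = 0
  has length 1 and expansion [0].\<close>

definition cf_length :: "real \<Rightarrow> enat" where
  "cf_length \<theta> = (if \<exists>k. conv_err \<theta> k = 0 then enat (LEAST k. conv_err \<theta> k = 0) else \<infinity>)"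

lemma less_cf_length_iff: "enat k < cf_length \<theta> \<longleftrightarrow> (\<forall>j\<le>k. 0 < conv_err \<theta> j)"
proof (cases "\<exists>k. conv_err \<theta> k = 0")
  case True
  let ?l = "LEAST k. conv_err \<theta> k = 0"
  have l: "conv_err \<theta> ?l = 0" using True by (rule LeastI_ex)
  have "k < ?l \<longleftrightarrow> (\<forall>j\<le>k. 0 < conv_err \<theta> j)"
  proof
    assume "k < ?l"
    then have "conv_err \<theta> j \<noteq> 0" if "j \<le> k" for j
      using not_less_Least[of j "\<lambda>k. conv_err \<theta> k = 0"] that by linarith
    then show "\<forall>j\<le>k. 0 < conv_err \<theta> j" using conv_err_nonneg by (auto simp: less_le)
  next
    assume "\<forall>j\<le>k. 0 < conv_err \<theta> j"
    with l show "k < ?l" by (metis less_irrefl not_less)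
  qed
  with True show ?thesis by (simp add: cf_length_def)
next
  case False
  then show ?thesis using conv_err_nonneg by (auto simp: cf_length_def less_le)
qed

lemma conv_err_cf_length:
  assumes "cf_length \<theta> = enat k"
  shows "conv_err \<theta> k = 0"
proof -
  have ex: "\<exists>k. conv_err \<theta> k = 0" using assms by (auto simp: cf_length_def split: if_splits)
  with assms have "k = (LEAST k. conv_err \<theta> k = 0)" by (simp add: cf_length_def)
  with LeastI_ex[OF ex] show ?thesis by simp
qed

text \<open>The point where \<open>x e\<^sup>-\<^sup>q = d e\<^sup>q\<close>.\<close>

definition crossing :: "real \<Rightarrow> real \<Rightarrow> real" where
  "crossing x d = ln (x / d) / 2"

lemma crossing_eq:
  assumes "0 < x" "0 < d"
  shows "x * exp (- crossing x d) = d * exp (crossing x d)"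
proof -
  have "exp (crossing x d) * exp (crossing x d) = x / d"
    using assms by (simp add: crossing_def flip: exp_add)
  then show ?thesis using assms by (simp add: exp_minus field_simps)
qed

lemma crossing_le_iff:
  assumes "0 < x" "0 < d"
  shows "crossing x d \<le> q \<longleftrightarrow> x * exp (- q) \<le> d * exp q"
    and "q \<le> crossing x d \<longleftrightarrow> d * exp q \<le> x * exp (- q)"
proof -
  have *: "x * exp (- p) < x * exp (- q) \<and> d * exp q < d * exp p" if "q < p" for p q :: real
    using that assms by simp
  show "crossing x d \<le> q \<longleftrightarrow> x * exp (- q) \<le> d * exp q"
    using crossing_eq[OF assms] *[of q "crossing x d"] *[of "crossing x d" q] by fastforce
  show "q \<le> crossing x d \<longleftrightarrow> d * exp q \<le> x * exp (- q)"
    using crossing_eq[OF assms] *[of q "crossing x d"] *[of "crossing x d" q] by fastforce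
qed

subsection \<open>Local maxima of the two minima\<close>

context
  fixes \<theta> :: real
  assumes \<theta>: "0 \<le> \<theta>" "\<theta> \<le> 1 / 2"
begin

section \<open>Decay of the errors and growth of the denominators\<close>

lemma conv_err_decreasing:
  assumes "enat k < cf_length \<theta>"
  shows "conv_err \<theta> (Suc k) < conv_err \<theta> k"
proof (cases k)
  case 0
  then show ?thesis using \<theta> by (simp add: conv_err_0 conv_err_1)
next
  case (Suc j)
  have pos: "0 < conv_err \<theta> k" using assms by (auto simp: less_cf_length_iff)
  have "conv_err \<theta> j / conv_err \<theta> k < real (partial_quot \<theta> j) + 1"
    unfolding partial_quot_def Suc[symmetric] by linarith
  then have "conv_err \<theta> j < (real (partial_quot \<theta> j) + 1) * conv_err \<theta> k" using pos by (simp add: field_simps)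
  then show ?thesis using conv_err_rec[OF \<theta>(1), of j] Suc by (simp add: algebra_simps)
qed

lemma less_cf_length_Suc: "enat (Suc k) < cf_length \<theta> \<Longrightarrow> enat k < cf_length \<theta>"
  by (simp add: less_cf_length_iff)

lemma cf_length_pos: "0 < cf_length \<theta>"
  using less_cf_length_iff[of 0 \<theta>] by (simp add: conv_err_0 zero_enat_def)

lemma partial_quot_pos:
  assumes "enat (Suc k) < cf_length \<theta>"
  shows "0 < partial_quot \<theta> k"
proof -
  have "0 < conv_err \<theta> (Suc k)" using assms by (auto simp: less_cf_length_iff)
  then have "1 \<le> conv_err \<theta> k / conv_err \<theta> (Suc k)"
    using conv_err_decreasing[OF less_cf_length_Suc[OF assms]] by simp
  then show ?thesis by (simp add: partial_quot_def)
qed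

text \<open>A last quotient 1 would make the two errors before the vanishing one equal,
  contradicting strict decrease.\<close>

lemma partial_quot_last:
  assumes "cf_length \<theta> = enat (Suc (Suc k))"
  shows "2 \<le> partial_quot \<theta> k"
proof (rule ccontr)
  assume "\<not> ?thesis"
  moreover have k: "enat (Suc k) < cf_length \<theta>" by (simp add: assms)
  ultimately have "partial_quot \<theta> k = 1" using partial_quot_pos[OF k] by simp
  then have "conv_err \<theta> k = conv_err \<theta> (Suc k)"
    using conv_err_rec[OF \<theta>(1), of k] conv_err_cf_length[OF assms] by simp
  with conv_err_decreasing[OF less_cf_length_Suc[OF k]] show False by simp
qed

lemma conv_denom_nonneg: "0 \<le> fst (conv_vec \<theta> k)"
  using adapted_basis_conv_vec[OF \<theta>(1), of k] by (simp add: adapted_basis_def)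

lemma conv_denom_Suc_Suc:
  "fst (conv_vec \<theta> (Suc (Suc k))) =
     fst (conv_vec \<theta> k) + real (partial_quot \<theta> k) * fst (conv_vec \<theta> (Suc k))"
  by (simp add: conv_vec_rec)

text \<open>The denominators start with 0, 1 and the first quotient, which is at least 2 because
  theta is at most 1/2. Each later step adds at least the denominator two places back, itself at
  least 1.\<close>

lemma conv_denom_growth:
  assumes "enat k < cf_length \<theta>"
  shows "real k \<le> fst (conv_vec \<theta> k)" "fst (conv_vec \<theta> k) + 1 \<le> fst (conv_vec \<theta> (Suc k))"
proof -
  have "real k \<le> fst (conv_vec \<theta> k) \<and> fst (conv_vec \<theta> k) + 1 \<le> fst (conv_vec \<theta> (Suc k))"
    using assms
  proof (induction k)
    case (Suc k)
    note IH = Suc.IH[OF less_cf_length_Suc[OF Suc.prems]]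
    have "fst (conv_vec \<theta> (Suc k)) + 1 \<le> fst (conv_vec \<theta> (Suc (Suc k)))"
    proof (cases "k = 0")
      case True
      have pos: "0 < \<theta>" using Suc.prems \<theta> True by (auto simp: less_cf_length_iff conv_err_1)
      have "2 \<le> 1 / \<theta>" using pos \<theta> by (simp add: field_simps)
      then have "2 \<le> partial_quot \<theta> 0"
        using \<theta> by (simp add: partial_quot_def conv_err_0 conv_err_1 le_nat_iff le_floor_iff)
      then show ?thesis using True by (simp add: conv_vec_rec)
    next
      case False
      have "1 * fst (conv_vec \<theta> (Suc k)) \<le> real (partial_quot \<theta> k) * fst (conv_vec \<theta> (Suc k))"
        using partial_quot_pos[OF Suc.prems] conv_denom_nonneg by (intro mult_right_mono) auto
      moreover have "1 \<le> real k" using False by simp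
      ultimately show ?thesis using IH unfolding conv_denom_Suc_Suc by linarith
    qed
    with IH show ?case by simp
  qed simp
  then show "real k \<le> fst (conv_vec \<theta> k)" "fst (conv_vec \<theta> k) + 1 \<le> fst (conv_vec \<theta> (Suc k))"
    by auto
qed

lemma conv_denom_pos: "enat k < cf_length \<theta> \<Longrightarrow> 0 < fst (conv_vec \<theta> (Suc k))"
  using conv_denom_growth[of k] by simp

lemma conv_err_pos: "enat k < cf_length \<theta> \<Longrightarrow> 0 < conv_err \<theta> k"
  by (auto simp: less_cf_length_iff)

lemma conv_err_le_1: "enat k < cf_length \<theta> \<Longrightarrow> conv_err \<theta> k \<le> 1"
proof (induction k)
  case (Suc k)
  then show ?case using conv_err_decreasing[of k] less_cf_length_Suc[of k] by force
qed (simp add: conv_err_0)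

section \<open>Crossing points of consecutive convergents\<close>

definition conv_crossing :: "nat \<Rightarrow> real" where
  "conv_crossing k = crossing (fst (conv_vec \<theta> (Suc k))) (conv_err \<theta> k)"

text \<open>Starting the sequence with (0, 1) makes the end point maximum at 0 an ordinary crossing,
  of (0, 1) with (1, 0).\<close>

lemma conv_crossing_0: "conv_crossing 0 = 0"
  by (simp add: conv_crossing_def crossing_def conv_err_0)

lemma conv_crossing_le_iff:
  assumes "enat k < cf_length \<theta>"
  shows "conv_crossing k \<le> q \<longleftrightarrow> fst (conv_vec \<theta> (Suc k)) * exp (- q) \<le> conv_err \<theta> k * exp q"
    and "q \<le> conv_crossing k \<longleftrightarrow> conv_err \<theta> k * exp q \<le> fst (conv_vec \<theta> (Suc k)) * exp (- q)"
  unfolding conv_crossing_def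
  using crossing_le_iff[OF conv_denom_pos[OF assms] conv_err_pos[OF assms]] by auto

lemma body_gauge_conv_vec:
  "body_gauge \<theta> q (conv_vec \<theta> k) = max (fst (conv_vec \<theta> k) * exp (- q)) (conv_err \<theta> k * exp q)"
  using conv_denom_nonneg[of k] by (simp add: body_gauge_def conv_err_def)

lemma conv_crossing_nonneg:
  assumes "enat k < cf_length \<theta>"
  shows "0 \<le> conv_crossing k"
  using conv_crossing_le_iff(2)[OF assms, of 0] conv_err_le_1[OF assms] conv_denom_growth[OF assms]
  by simp

lemma conv_crossing_unbounded:
  assumes "cf_length \<theta> = \<infinity>"
  shows "\<exists>k. q < conv_crossing k"
proof -
  \<comment> \<open>The next denominator then exceeds e^(2q) while the error is at most 1, so at q
    the crossing still lies ahead.\<close>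
  obtain k :: nat where k: "exp (2 * q) < real k" using reals_Archimedean2 by blast
  have kK: "enat k < cf_length \<theta>" by (simp add: assms)
  have "exp q * exp q < fst (conv_vec \<theta> (Suc k))"
    using k conv_denom_growth[OF kK] by (simp flip: exp_add)
  then have "exp q < fst (conv_vec \<theta> (Suc k)) * exp (- q)" by (simp add: exp_minus field_simps)
  moreover have "conv_err \<theta> k * exp q \<le> 1 * exp q" using conv_err_le_1[OF kK] by (intro mult_right_mono) auto
  ultimately have "\<not> conv_crossing k \<le> q" unfolding conv_crossing_le_iff[OF kK] by linarith
  then show ?thesis by (auto simp: not_le)
qed

lemma local_maxima_on_succ_min_1:
  shows "strict_mono_on {k. enat k < cf_length \<theta>} conv_crossing"
    and "local_maxima_on {0..} (\<lambda>q. succ_min 1 (convex_body \<theta> (exp q))) =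
           conv_crossing ` {k. enat k < cf_length \<theta>}"
proof -
  note basis = adapted_basis_conv_vec[OF \<theta>(1)]
  have upper: "succ_min 1 (convex_body \<theta> (exp q)) \<le> max (fst (conv_vec \<theta> k) * exp (- q)) (conv_err \<theta> k * exp q)"
    for k q
    unfolding body_gauge_conv_vec[symmetric]
    by (rule succ_min_1_le) (use basis[of k] adapted_basis_nonzero[OF basis[of k]] in \<open>auto simp: adapted_basis_def\<close>)
  have lower: "min (fst (conv_vec \<theta> (Suc k)) * exp (- q)) (conv_err \<theta> k * exp q) \<le> succ_min 1 (convex_body \<theta> (exp q))"
    for k q
    using succ_min_1_attained[of \<theta> q] body_gauge_ge_adapted[OF basis[of k], of _ q]
    unfolding conv_err_def by (meson order_trans)
  have cross: "fst (conv_vec \<theta> (Suc k)) * exp (- conv_crossing k) = conv_err \<theta> k * exp (conv_crossing k)"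
    if "enat k < cf_length \<theta>" for k
    unfolding conv_crossing_def by (rule crossing_eq[OF conv_denom_pos[OF that] conv_err_pos[OF that]])
  \<comment> \<open>For finite length the last error is 0, so after the last crossing the envelope
    only falls.\<close>
  have right: "conv_err \<theta> (Suc N) * exp q \<le> fst (conv_vec \<theta> (Suc N)) * exp (- q)"
    if "cf_length \<theta> = enat (Suc N)" for N q
    using conv_err_cf_length[OF that] conv_denom_nonneg by simp
  have inc: "fst (conv_vec \<theta> k) < fst (conv_vec \<theta> (Suc k))" if "enat k < cf_length \<theta>" for k
    using conv_denom_growth(2)[OF that] by simp
  note * = local_maxima_on_eq_crossings[where X = "\<lambda>k. fst (conv_vec \<theta> k)" and D = "conv_err \<theta>"
      and c = conv_crossing and S = "{0..}" and K = "cf_length \<theta>"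
      and f = "\<lambda>q. succ_min 1 (convex_body \<theta> (exp q))",
      OF _ cf_length_pos conv_denom_nonneg conv_err_nonneg inc conv_err_decreasing _ cross
        conv_crossing_unbounded upper lower _ right]
  \<comment> \<open>\<open>left\<close> holds because no point of the domain lies before the first
    crossing, which is 0.\<close>
  show "strict_mono_on {k. enat k < cf_length \<theta>} conv_crossing"
    by (rule *(1)) (auto simp: conv_crossing_0 conv_crossing_nonneg)
  show "local_maxima_on {0..} (\<lambda>q. succ_min 1 (convex_body \<theta> (exp q))) =
           conv_crossing ` {k. enat k < cf_length \<theta>}"
    by (rule *(2)) (auto simp: conv_crossing_0 conv_crossing_nonneg)
qed

text \<open>On this interval v attains the first minimum, and the second is the lower envelope of
  the gauges of \<open>w 0\<close>, ..., \<open>w N\<close>: N + 1 points with N crossings, N being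
  the partial quotient.\<close>

lemma local_maxima_on_succ_min_2:
  assumes m: "enat (Suc m) < cf_length \<theta>"
  defines "M \<equiv> local_maxima_on {conv_crossing m..conv_crossing (Suc m)}
                 (\<lambda>q. succ_min 2 (convex_body \<theta> (exp q)))"
  shows "finite M" "card M = partial_quot \<theta> m"
proof -
  note basis = adapted_basis_conv_vec[OF \<theta>(1)]
  note m' = less_cf_length_Suc[OF m]
  define v where "v = conv_vec \<theta> (Suc m)"
  \<comment> \<open>\<open>w 0\<close> is the convergent before v and \<open>w N\<close> the one
    after it; between them are the intermediate convergents.\<close>
  define w where "w k = conv_vec \<theta> m + real k *\<^sub>R v" for k
  define N where "N = partial_quot \<theta> m"
  define X where "X k = fst (w k)" for k
  define E where "E k = \<bar>linear_form \<theta> (w k)\<bar>" for k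
  define c where "c k = crossing (X (Suc k)) (E k)" for k
  let ?S = "{conv_crossing m..conv_crossing (Suc m)}"
  have kN: "real k * \<bar>linear_form \<theta> v\<bar> \<le> \<bar>linear_form \<theta> (conv_vec \<theta> m)\<bar>" if "k \<le> N" for k
  proof -
    have "real k * \<bar>linear_form \<theta> v\<bar> \<le> real N * \<bar>linear_form \<theta> v\<bar>"
      using that by (intro mult_right_mono) auto
    also have "\<dots> \<le> \<bar>linear_form \<theta> (conv_vec \<theta> m)\<bar>"
      using partial_quot_le[of \<theta> m] by (simp add: conv_err_def v_def N_def)
    finally show ?thesis .
  qed
  have vw: "adapted_basis \<theta> v (w k)" and E: "E k = conv_err \<theta> m - real k * conv_err \<theta> (Suc m)"
    if "k \<le> N" for k
    using adapted_basis_step[OF basis[of m, folded v_def] kN[OF that]]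
    by (simp_all add: w_def E_def conv_err_def v_def)
  have X: "X k = fst (conv_vec \<theta> m) + real k * fst v" for k by (simp add: X_def w_def)
  have vpos: "0 < fst v" unfolding v_def by (rule conv_denom_pos[OF m'])
  have dpos: "0 < conv_err \<theta> (Suc m)" by (rule conv_err_pos[OF m])
  have X0: "0 \<le> X k" for k using conv_denom_nonneg[of m] vpos by (simp add: X)
  have Xmono: "X j \<le> X k" if "j \<le> k" for j k
    using that vpos unfolding X by (intro add_left_mono mult_right_mono) auto
  have Xinc: "X k < X (Suc k)" for k using vpos by (simp add: X algebra_simps)
  have Xpos: "0 < X (Suc k)" for k using Xinc[of k] X0[of k] by linarith
  have E0: "0 \<le> E k" for k by (simp add: E_def)
  have Edec: "E k = E (Suc k) + conv_err \<theta> (Suc m)" if "k < N" for k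
    using E[of k] E[of "Suc k"] that by (simp add: algebra_simps)
  have Ege: "conv_err \<theta> (Suc m) \<le> E k" if "k < N" for k using Edec[OF that] E0[of "Suc k"] by simp
  have Epos: "0 < E k" if "k < N" for k using Ege[OF that] dpos by linarith
  have Ele: "E k \<le> conv_err \<theta> m" if "k \<le> N" for k using E[OF that] dpos by simp
  have XN: "X N = fst (conv_vec \<theta> (Suc (Suc m)))" by (simp add: X v_def N_def conv_denom_Suc_Suc)
  have EN: "E N = conv_err \<theta> (Suc (Suc m))" using E[of N] conv_err_rec[OF \<theta>(1), of m] by (simp add: N_def)
  have X1: "fst v \<le> X (Suc k)" for k
    using Xmono[of 1 "Suc k"] conv_denom_nonneg[of m] by (simp add: X)
  have Npos: "0 < N" unfolding N_def by (rule partial_quot_pos[OF m])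
  have cross: "X (Suc k) * exp (- c k) = E k * exp (c k)" if "k < N" for k
    unfolding c_def by (rule crossing_eq[OF Xpos Epos[OF that]])
  \<comment> \<open>End points do occur: \<open>c 0\<close> is the left one for m = 0, and
    \<open>c (N - 1)\<close> the right one when \<open>conv_err \<theta> (Suc (Suc m))\<close> is 0.
    Maxima of the restriction at end points therefore have to count.\<close>
  have cS: "c k \<in> ?S" if "k < N" for k
  proof -
    have "fst v * exp (- c k) \<le> X (Suc k) * exp (- c k)" using X1 by (intro mult_right_mono) auto
    moreover have "E k * exp (c k) \<le> conv_err \<theta> m * exp (c k)" using Ele that by (intro mult_right_mono) auto
    ultimately have 1: "conv_crossing m \<le> c k"
      unfolding conv_crossing_le_iff[OF m'] v_def[symmetric] using cross[OF that] by linarith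
    have "X (Suc k) * exp (- c k) \<le> X N * exp (- c k)" using Xmono that by (intro mult_right_mono) auto
    moreover have "conv_err \<theta> (Suc m) * exp (c k) \<le> E k * exp (c k)" using Ege[OF that] by (intro mult_right_mono) auto
    ultimately have "c k \<le> conv_crossing (Suc m)"
      unfolding conv_crossing_le_iff[OF m] XN[symmetric] using cross[OF that] by linarith
    with 1 show ?thesis by simp
  qed
  \<comment> \<open>To the right of the left end, the bound from the basis at m is the falling
    branch of v; to the left of the right end, the bound from the basis at \<open>Suc m\<close> is
    its rising branch.\<close>
  have v_min: "body_gauge \<theta> q v \<le> body_gauge \<theta> q p" if "q \<in> ?S" "p \<in> int_lattice" "p \<noteq> 0" for p q
  proof -
    have "fst v * exp (- q) \<le> body_gauge \<theta> q p"
      using body_gauge_ge_adapted[OF basis[of m] that(2,3), of q] that(1)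
      by (simp add: conv_crossing_le_iff[OF m'] v_def conv_err_def)
    moreover have "conv_err \<theta> (Suc m) * exp q \<le> body_gauge \<theta> q p"
      using body_gauge_ge_adapted[OF basis[of "Suc m"] that(2,3), of q] that(1)
      by (simp add: conv_crossing_le_iff[OF m] conv_err_def)
    ultimately show ?thesis unfolding v_def body_gauge_conv_vec by simp
  qed
  have upper: "succ_min 2 (convex_body \<theta> (exp q)) \<le> max (X k * exp (- q)) (E k * exp q)"
    if "k \<le> N" "q \<in> ?S" for k q
  proof -
    have "det2 v (w k) \<noteq> 0" "v \<in> int_lattice" "w k \<in> int_lattice"
      using vw[OF that(1)] by (auto simp: adapted_basis_def)
    then have "succ_min 2 (convex_body \<theta> (exp q)) \<le> max (body_gauge \<theta> q v) (body_gauge \<theta> q (w k))"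
      by (intro succ_min_2_le)
    also have "\<dots> = body_gauge \<theta> q (w k)"
      using v_min[OF that(2) \<open>w k \<in> int_lattice\<close> adapted_basis_nonzero(2)[OF vw[OF that(1)]]] by simp
    finally show ?thesis using X0[of k] by (simp add: body_gauge_def X_def E_def)
  qed
  have lower: "min (X (Suc k) * exp (- q)) (E k * exp q) \<le> succ_min 2 (convex_body \<theta> (exp q))"
    if "k < N" for k q
  proof -
    have kle: "k \<le> N" using that by simp
    \<comment> \<open>As \<open>w (Suc k)\<close> is \<open>w k + v\<close>, the sum of first
      coordinates in the bound for points off the line of v belongs to the next intermediate
      convergent.\<close>
    have "X (Suc k) = fst v + fst (w k)" by (simp add: X_def w_def algebra_simps)
    then show ?thesis
      using succ_min_2_attained[OF adapted_basis_nonzero(1)[OF vw[OF kle]], of \<theta> q]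
        body_gauge_ge_adapted_independent[OF vw[OF kle], of _ q]
      unfolding E_def by (metis order_trans)
  qed
  \<comment> \<open>On the whole interval \<open>w 0\<close> is on its rising branch, its X being
    below that of v, and \<open>w N\<close> on its falling branch, its error being below that of
    v.\<close>
  have left: "X 0 * exp (- q) \<le> E 0 * exp q" if "q \<in> ?S" for q
  proof -
    have "X 0 * exp (- q) \<le> fst v * exp (- q)"
      using conv_denom_growth(2)[OF m'] by (intro mult_right_mono) (auto simp: X v_def)
    also have "\<dots> \<le> E 0 * exp q"
      using that by (simp add: conv_crossing_le_iff[OF m'] E v_def)
    finally show ?thesis .
  qed
  have right: "E N * exp q \<le> X N * exp (- q)" if "q \<in> ?S" for q
  proof -
    have "E N * exp q \<le> conv_err \<theta> (Suc m) * exp q"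
      using conv_err_decreasing[OF m] by (intro mult_right_mono) (auto simp: EN)
    also have "\<dots> \<le> X N * exp (- q)"
      using that by (simp add: conv_crossing_le_iff[OF m] XN)
    finally show ?thesis .
  qed
  have N0: "0 < enat N" using Npos by (simp add: zero_enat_def)
  have S: "{a..b} \<subseteq> ?S" if "a \<in> ?S" "b \<in> ?S" for a b using that by auto
  have Edec': "E (Suc k) < E k" if "k < N" for k using Edec[OF that] dpos by simp
  have right': "E (Suc n) * exp q \<le> X (Suc n) * exp (- q)" if "enat N = enat (Suc n)" "q \<in> ?S" for q n
    using right[OF that(2)] that(1) by simp
  \<comment> \<open>The number of crossings is finite here, so the unboundedness premise follows
    from \<open>enat N \<noteq> \<infinity>\<close>.\<close>
  note * = local_maxima_on_eq_crossings[where X = X and D = E and c = c and S = ?S and K = "enat N"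
      and f = "\<lambda>q. succ_min 2 (convex_body \<theta> (exp q))", unfolded enat_ord_simps,
      OF S N0 X0 E0 Xinc Edec' cS cross enat.distinct(1)[THEN notE] upper lower left right']
  have mono: "strict_mono_on {k. k < N} c" by (rule *(1))
  have M: "M = c ` {k. k < N}" unfolding M_def by (rule *(2))
  show "finite M" "card M = partial_quot \<theta> m"
    using card_image[OF strict_mono_on_imp_inj_on[OF mono]] by (auto simp: M N_def)
qed

end

subsection \<open>Continued fractions\<close>

text \<open>For a nonempty list this is [0, a1, ..., am + z]. The free z lets the last quotient be
  split off, as induction along the convergents requires, whereas \<open>cfrac\<close> peels off the
  first.\<close>

fun cfrac_tail :: "real \<Rightarrow> nat list \<Rightarrow> real" where
  "cfrac_tail z [] = z"
| "cfrac_tail z (a # as) = 1 / (real a + cfrac_tail z as)"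

lemma cfrac_eq_tail: "cfrac a0 as = of_int a0 + cfrac_tail 0 as"
  by (induction as arbitrary: a0) auto

lemma cfrac_tail_snoc: "cfrac_tail z (as @ [a]) = cfrac_tail (1 / (real a + z)) as"
  by (induction as) auto

text \<open>The classical Moebius formula for a continued fraction with free tail. The last quotient
  a is absorbed into the tail, which becomes 1/t with t = a + z; multiplying through by t gives the
  recursion of the convergents.\<close>

lemma cfrac_tail_conv_vec:
  assumes "0 \<le> z" "\<And>k. k < m \<Longrightarrow> 0 < partial_quot \<theta> k"
  shows "cfrac_tail z (map (partial_quot \<theta>) [0..<m]) =
    (snd (conv_vec \<theta> (Suc m)) + z * snd (conv_vec \<theta> m)) / (fst (conv_vec \<theta> (Suc m)) + z * fst (conv_vec \<theta> m))"
  using assms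
proof (induction m arbitrary: z)
  case (Suc m)
  define t where "t = real (partial_quot \<theta> m) + z"
  have t: "0 < t" using Suc.prems(1) Suc.prems(2)[of m] by (simp add: t_def)
  have "cfrac_tail z (map (partial_quot \<theta>) [0..<Suc m]) = cfrac_tail (1 / t) (map (partial_quot \<theta>) [0..<m])"
    by (simp add: cfrac_tail_snoc t_def)
  also have "\<dots> = (snd (conv_vec \<theta> (Suc m)) + 1 / t * snd (conv_vec \<theta> m)) /
      (fst (conv_vec \<theta> (Suc m)) + 1 / t * fst (conv_vec \<theta> m))"
    using t Suc.prems(2) by (intro Suc.IH) auto
  also have "\<dots> = (t * (snd (conv_vec \<theta> (Suc m)) + 1 / t * snd (conv_vec \<theta> m))) /
      (t * (fst (conv_vec \<theta> (Suc m)) + 1 / t * fst (conv_vec \<theta> m)))"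
    using t by (intro mult_divide_mult_cancel_left[symmetric]) simp
  also have "\<dots> = (snd (conv_vec \<theta> (Suc (Suc m))) + z * snd (conv_vec \<theta> (Suc m))) /
      (fst (conv_vec \<theta> (Suc (Suc m))) + z * fst (conv_vec \<theta> (Suc m)))"
    using t by (simp add: conv_vec_rec distrib_left) (simp add: t_def algebra_simps)
  finally show ?case .
qed simp

lemma cfrac_partial_quot:
  assumes "\<And>k. k < m \<Longrightarrow> 0 < partial_quot \<theta> k"
  shows "cfrac 0 (map (partial_quot \<theta>) [0..<m]) = snd (conv_vec \<theta> (Suc m)) / fst (conv_vec \<theta> (Suc m))"
  using cfrac_tail_conv_vec[OF order_refl assms] by (simp add: cfrac_eq_tail)

text \<open>The vanishing last error says that theta equals the last convergent.\<close>

lemma has_finite_cfrac_partial_quot: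
  assumes \<theta>: "0 \<le> \<theta>" "\<theta> \<le> 1 / 2" and len: "cf_length \<theta> = enat (Suc m)"
  shows "has_finite_cfrac \<theta> 0 (map (partial_quot \<theta>) [0..<m])"
proof -
  have pos: "0 < partial_quot \<theta> k" if "k < m" for k
    using partial_quot_pos[OF \<theta>] len that by simp
  have "0 < fst (conv_vec \<theta> (Suc m))" using conv_denom_pos[OF \<theta>] len by simp
  moreover have "fst (conv_vec \<theta> (Suc m)) * \<theta> = snd (conv_vec \<theta> (Suc m))"
    using conv_err_cf_length[OF len] by (simp add: conv_err_def linear_form_def)
  ultimately have "\<theta> = snd (conv_vec \<theta> (Suc m)) / fst (conv_vec \<theta> (Suc m))" by (simp add: field_simps)
  then have "\<theta> = cfrac 0 (map (partial_quot \<theta>) [0..<m])" using cfrac_partial_quot[of m \<theta>] pos by simp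
  moreover have "\<forall>a \<in> set (map (partial_quot \<theta>) [0..<m]). 1 \<le> a" using pos by force
  ultimately show ?thesis by (simp add: has_finite_cfrac_def)
qed

text \<open>The distance to theta is error over denominator, with error at most 1 and denominator at
  least m + 1.\<close>

lemma cfrac_partial_quot_tendsto:
  assumes \<theta>: "0 \<le> \<theta>" "\<theta> \<le> 1 / 2" and len: "cf_length \<theta> = \<infinity>"
  shows "(\<lambda>m. cfrac 0 (map (partial_quot \<theta>) [0..<m])) \<longlonglongrightarrow> \<theta>"
proof -
  have "\<bar>cfrac 0 (map (partial_quot \<theta>) [0..<m]) - \<theta>\<bar> \<le> inverse (real (Suc m))" for m
  proof -
    let ?x = "fst (conv_vec \<theta> (Suc m))"
    have x: "real (Suc m) \<le> ?x" using conv_denom_growth(1)[OF \<theta>, of "Suc m"] len by simp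
    then have x0: "0 < ?x" by simp
    have "cfrac 0 (map (partial_quot \<theta>) [0..<m]) - \<theta> = (snd (conv_vec \<theta> (Suc m)) - ?x * \<theta>) / ?x"
      using cfrac_partial_quot[of m \<theta>] partial_quot_pos[OF \<theta>] len x0 by (simp add: diff_divide_distrib)
    then have "\<bar>cfrac 0 (map (partial_quot \<theta>) [0..<m]) - \<theta>\<bar> = conv_err \<theta> (Suc m) / ?x"
      using x0 by (simp add: conv_err_def linear_form_def abs_minus_commute)
    also have "\<dots> \<le> 1 / ?x" using conv_err_le_1[OF \<theta>, of "Suc m"] len x0 by (intro divide_right_mono) auto
    also have "\<dots> \<le> 1 / real (Suc m)" using x by (intro divide_left_mono) auto
    finally show ?thesis by (simp add: inverse_eq_divide)
  qed
  then have "(\<lambda>m. cfrac 0 (map (partial_quot \<theta>) [0..<m]) - \<theta>) \<longlonglongrightarrow> 0"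
    by (intro Lim_null_comparison[OF _ LIMSEQ_inverse_real_of_nat]) auto
  then show ?thesis by (rule LIM_zero_cancel)
qed

subsection \<open>The main theorem\<close>

lemma increasing_enumeration_le:
  assumes q: "increasing_enumeration A s q" and c: "increasing_enumeration A t c"
    and n: "enat n < s" and eq: "\<And>m. m < n \<Longrightarrow> q m = c m"
  shows "enat n < t \<and> c n \<le> q n"
proof -
  have q_mono: "strict_mono_on {n. enat n < s} q" and c_mono: "strict_mono_on {n. enat n < t} c"
    using q c by (auto simp: increasing_enumeration_def)
  have "q n \<in> A" using q n by (auto simp: increasing_enumeration_def)
  then obtain m where m: "enat m < t" "q n = c m" using c by (auto simp: increasing_enumeration_def)
  have "n \<le> m"
  proof (rule ccontr)
    assume "\<not> n \<le> m"
    then have mn: "m < n" by simp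
    then have "q m < q n"
      using strict_mono_onD[OF q_mono, of m n] n less_trans[of "enat m" "enat n" s] by simp
    with eq[OF mn] m(2) show False by simp
  qed
  then have nt: "enat n < t" using m(1) by (meson enat_ord_simps(1) le_less_trans)
  moreover have "c n \<le> c m"
  proof (cases "n = m")
    case False
    then show ?thesis using strict_mono_onD[OF c_mono, of n m] m(1) nt \<open>n \<le> m\<close> by simp
  qed simp
  ultimately show ?thesis using m(2) by simp
qed

text \<open>The final statement concerns every enumeration, so an arbitrary one must be identified
  with \<open>conv_crossing\<close>. By strong induction, two that agree below n bound each other at
  n.\<close>

lemma increasing_enumeration_unique:
  assumes q: "increasing_enumeration A s q" and c: "increasing_enumeration A t c"
  shows "s = t" "enat n < t \<Longrightarrow> q n = c n"
proof -
  have *: "(enat n < s \<longleftrightarrow> enat n < t) \<and> (enat n < t \<longrightarrow> q n = c n)" for n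
  proof (induction n rule: less_induct)
    case (less n)
    have eq: "q m = c m" if "m < n" "enat n < s \<or> enat n < t" for m
      using less[OF that(1)] that by (meson enat_ord_simps(2) less_trans)
    show ?case
      using increasing_enumeration_le[OF q c, of n] increasing_enumeration_le[OF c q, of n] eq
      by (metis order_antisym)
  qed
  \<comment> \<open>An extended natural is determined by the naturals below it.\<close>
  have "\<not> s < t" if "\<And>n. enat n < t \<Longrightarrow> enat n < s" for s t :: enat
    using that by (cases s) auto
  then show "s = t" using * by (meson not_less_iff_gr_or_eq)
  show "q n = c n" if "enat n < t" using * that by blast
qed

lemma dist_int_bounds: "0 \<le> dist_int \<xi>" "dist_int \<xi> \<le> 1 / 2"
  using of_int_round_abs_le[of \<xi>] by (auto simp: dist_int_def abs_minus_commute)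

theorem mainTheorem1:
  fixes \<xi> :: real
  shows "combined_graph \<xi> = combined_graph (dist_int \<xi>) \<and>
    (\<exists>s q. increasing_enumeration (local_maxima_on {0..} (L \<xi> 1)) s q) \<and>
    (\<forall>s q a.
       increasing_enumeration (local_maxima_on {0..} (L \<xi> 1)) s q \<longrightarrow>
       (\<forall>n. 1 \<le> n \<and> enat n < s \<longrightarrow> a n = card (local_maxima_on {q (n - 1)..q n} (L \<xi> 2))) \<longrightarrow>
       1 \<le> s \<and> q 0 = 0 \<and>
       (\<forall>n. 1 \<le> n \<and> enat n < s \<longrightarrow> finite (local_maxima_on {q (n - 1)..q n} (L \<xi> 2))) \<and>
       (s = 1 \<longrightarrow> has_finite_cfrac (dist_int \<xi>) 0 []) \<and>
       (\<forall>m. s = enat m \<and> 2 \<le> m \<longrightarrow>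
          has_finite_cfrac (dist_int \<xi>) 0 (map a [1..<m]) \<and> 2 \<le> a (m - 1)) \<and>
       (s = \<infinity> \<longrightarrow> has_infinite_cfrac (dist_int \<xi>) 0 a))"
proof (intro conjI)
  define \<theta> where "\<theta> = dist_int \<xi>"
  have \<theta>: "0 \<le> \<theta>" "\<theta> \<le> 1 / 2" using dist_int_bounds by (auto simp: \<theta>_def)
  have L: "L \<xi> = L \<theta>" by (rule ext) (simp add: \<theta>_def L_dist_int)
  show "combined_graph \<xi> = combined_graph (dist_int \<xi>)"
    unfolding combined_graph_def L_dist_int ..
  define c where "c = conv_crossing \<theta>"
  \<comment> \<open>The crossings witness existence and, by uniqueness, stand for any given
    enumeration.\<close>
  have enum: "increasing_enumeration (local_maxima_on {0..} (L \<xi> 1)) (cf_length \<theta>) c"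
    using local_maxima_on_succ_min_1[OF \<theta>]
    by (simp add: increasing_enumeration_def L local_maxima_on_L c_def)
  then show "\<exists>s q. increasing_enumeration (local_maxima_on {0..} (L \<xi> 1)) s q" by blast
  show "\<forall>s q a.
       increasing_enumeration (local_maxima_on {0..} (L \<xi> 1)) s q \<longrightarrow>
       (\<forall>n. 1 \<le> n \<and> enat n < s \<longrightarrow> a n = card (local_maxima_on {q (n - 1)..q n} (L \<xi> 2))) \<longrightarrow>
       1 \<le> s \<and> q 0 = 0 \<and>
       (\<forall>n. 1 \<le> n \<and> enat n < s \<longrightarrow> finite (local_maxima_on {q (n - 1)..q n} (L \<xi> 2))) \<and>
       (s = 1 \<longrightarrow> has_finite_cfrac (dist_int \<xi>) 0 []) \<and>
       (\<forall>m. s = enat m \<and> 2 \<le> m \<longrightarrow>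
          has_finite_cfrac (dist_int \<xi>) 0 (map a [1..<m]) \<and> 2 \<le> a (m - 1)) \<and>
       (s = \<infinity> \<longrightarrow> has_infinite_cfrac (dist_int \<xi>) 0 a)"
  proof (intro allI impI)
    fix s q and a :: "nat \<Rightarrow> nat"
    assume q: "increasing_enumeration (local_maxima_on {0..} (L \<xi> 1)) s q"
      and a: "\<forall>n. 1 \<le> n \<and> enat n < s \<longrightarrow> a n = card (local_maxima_on {q (n - 1)..q n} (L \<xi> 2))"
    note s = increasing_enumeration_unique(1)[OF q enum]
    note qc = increasing_enumeration_unique(2)[OF q enum]
    have s0: "0 < s" using cf_length_pos[OF \<theta>] by (simp add: s)
    have max2: "finite (local_maxima_on {q (n - 1)..q n} (L \<xi> 2))"
      "card (local_maxima_on {q (n - 1)..q n} (L \<xi> 2)) = partial_quot \<theta> (n - 1)"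
      if n: "1 \<le> n" "enat n < s" for n
    proof -
      obtain k where k: "n = Suc k" using n(1) by (cases n) auto
      have "enat (Suc k) < cf_length \<theta>" using n(2) s k by simp
      from local_maxima_on_succ_min_2[OF \<theta> this] qc[of n] qc[of k] this less_cf_length_Suc[OF \<theta> this]
      show "finite (local_maxima_on {q (n - 1)..q n} (L \<xi> 2))"
        "card (local_maxima_on {q (n - 1)..q n} (L \<xi> 2)) = partial_quot \<theta> (n - 1)"
        by (simp_all add: L local_maxima_on_L c_def k)
    qed
    have a_eq: "a n = partial_quot \<theta> (n - 1)" if "1 \<le> n" "enat n < s" for n
      using a max2(2)[OF that] that by simp
    \<comment> \<open>Index shift: the given quotients start at 1, \<open>partial_quot\<close> at
      0.\<close>
    have map_a: "map a [1..<Suc m] = map (partial_quot \<theta>) [0..<m]" if "\<And>n. n \<le> m \<Longrightarrow> enat n < s" for m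
      by (rule nth_equalityI) (auto simp: a_eq that simp del: upt_Suc)
    have "1 \<le> s" using s0 by (simp add: one_enat_def zero_enat_def Suc_ile_eq)
    moreover have "q 0 = 0"
      using qc[of 0] s s0 conv_crossing_0[OF \<theta>] by (simp add: c_def zero_enat_def)
    moreover have "has_finite_cfrac (dist_int \<xi>) 0 []" if "s = 1"
      using has_finite_cfrac_partial_quot[OF \<theta>, of 0] that s by (simp add: one_enat_def \<theta>_def)
    moreover have "has_finite_cfrac (dist_int \<xi>) 0 (map a [1..<m]) \<and> 2 \<le> a (m - 1)"
      if m: "s = enat m" "2 \<le> m" for m
    proof -
      obtain k where k: "m = Suc (Suc k)" using m(2) by (metis Suc_le_D numeral_2_eq_2 Suc_le_mono)
      have "map a [1..<m] = map (partial_quot \<theta>) [0..<Suc k]"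
        unfolding k by (rule map_a) (simp add: m(1) k)
      moreover have "cf_length \<theta> = enat (Suc (Suc k))" using m(1) k s by simp
      moreover have "a (m - 1) = partial_quot \<theta> k" using a_eq[of "Suc k"] m(1) k by simp
      ultimately show ?thesis
        using has_finite_cfrac_partial_quot[OF \<theta>, of "Suc k"] partial_quot_last[OF \<theta>, of k] by (simp add: \<theta>_def)
    qed
    moreover have "has_infinite_cfrac (dist_int \<xi>) 0 a" if inf: "s = \<infinity>"
    proof -
      have len: "cf_length \<theta> = \<infinity>" using inf s by simp
      have "1 \<le> a n" if "1 \<le> n" for n
        using a_eq[OF that] partial_quot_pos[OF \<theta>, of "n - 1"] inf len by simp
      moreover have "(\<lambda>m. cfrac 0 (map a [1..<Suc m])) \<longlonglongrightarrow> \<theta>"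
        using cfrac_partial_quot_tendsto[OF \<theta> len] map_a inf by simp
      ultimately show ?thesis by (simp add: has_infinite_cfrac_def \<theta>_def)
    qed
    ultimately show "1 \<le> s \<and> q 0 = 0 \<and>
       (\<forall>n. 1 \<le> n \<and> enat n < s \<longrightarrow> finite (local_maxima_on {q (n - 1)..q n} (L \<xi> 2))) \<and>
       (s = 1 \<longrightarrow> has_finite_cfrac (dist_int \<xi>) 0 []) \<and>
       (\<forall>m. s = enat m \<and> 2 \<le> m \<longrightarrow>
          has_finite_cfrac (dist_int \<xi>) 0 (map a [1..<m]) \<and> 2 \<le> a (m - 1)) \<and>
       (s = \<infinity> \<longrightarrow> has_infinite_cfrac (dist_int \<xi>) 0 a)"
      using max2(1) by blast
  qed
qed

end
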